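(* Let $\mathcal{L}=\tilde{\mathcal{L}}_H+\mathcal{L}_Q+\mathcal{L}_R$ be the generator of the Hamiltonian PD-MCMC on $\mathbb{R}^d\times\mathbb{R}^d$. Then, for any potential $\hat V=\hat V(x)$ such that the second addend of $$\mathcal{S}_{\hat V}(f)=\iint f(x,v)\log f(x,v)\,dx\,dv+\iint f(x,v)\left(\hat V(x)+\frac{|v|^2}{2}\right)dx\,dv$$ is integrable, the operator $\mathcal{L}'$ can be written in the form $$\mathcal{L}'\rho=\tilde W(\rho)+\mathbf{d}_\xi\tilde\psi^\star\left(\rho;-\frac{\mathbf{d}\mathcal{S}_{\hat V}(\rho)}{2}\right),$$ where $\tilde W(\rho)=\mathcal{L}_A'\rho$ and, for every $\rho\in\mathcal{V}$, $\tilde\psi^\star(\rho;\xi)=\psi^\star(\rho;\xi)+\hat\psi^\star(\rho;\xi)$, with $$\psi^\star(\rho;\xi)=\frac{\lambda_r}{(2\pi)^{d/2}}\iiint\left[\cosh(\xi(x,v')-\xi(x,v))-1\right]e^{-\frac{|v|^2+|v'|^2}{4}}\sqrt{\rho(x,v)\rho(x,v')}\,dx\,dv\,dv'$$ and $$\hat\psi^\star(\rho;\xi)=\frac12\iint(a_++a_-)(x,v)\sqrt{\rho(x,R_x^{\tilde U}v)\,\rho(x,v)}\left[\cosh\left(\xi(x,R_x^{\tilde U}v)-\xi(x,v)\right)-1\right]dx\,dv,$$ and $\tilde\psi^\star$ is positive (i.e. $\ge0$) and convex in the second argument.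
   Context: $V,\tilde V:\mathbb{R}^d\to\mathbb{R}$ are potentials, $\tilde U=V-\tilde V$, $\lambda_r>0$ is a constant, $\pi_0(v)=(2\pi)^{-d/2}e^{-|v|^2/2}$ is the standard Gaussian density (also the corresponding measure), and $\mu(x,v)=e^{-V(x)}e^{-|v|^2/2}$ (normalisation constant included in $V$, so $\mu$ is a probability density). Generator on functions $f(x,v)$, $(x,v)\in\mathbb{R}^d\times\mathbb{R}^d$: $\mathcal{L}=\tilde{\mathcal{L}}_H+\mathcal{L}_Q+\mathcal{L}_R$ with - $(\tilde{\mathcal{L}}_Hf)(x,v)=v\cdot\nabla_xf(x,v)-\nabla_x\tilde V(x)\cdot\nabla_vf(x,v)$; - $(\mathcal{L}_Qf)(x,v)=\lambda_r\left[\int_{\mathbb{R}^d}f(x,w)\,d\pi_0(w)-f(x,v)\right]$; - $(\mathcal{L}_Rf)(x,v)=\tilde\lambda(x,v)[f(x,R_x^{\tilde U}v)-f(x,v)]$, where $a(x,v)=v\cdot\nabla_x\tilde U(x)$, $a_+$ and $a_-$ are its positive and negative parts ($a=a_+-a_-$), $\tilde\lambda=a_+$, and $R_x^{\tilde U}v=v-\frac{2(v\cdot\nabla_x\tilde U)}{\|\nabla_x\tilde U\|^2}\nabla_x\tilde U$. A prime $'$ denotes the formal adjoint in $L^2(\mathbb{R}^{2d})$, a star on an operator the adjoint in $L^2_\mu$. $\mathcal{L}_A=\frac{\mathcal{L}-\mathcal{L}^*}{2}$ is the antisymmetric part of $\mathcal{L}$ in $L^2_\mu$, explicitly $(\mathcal{L}_Af)(x,v)=(\tilde{\mathcal{L}}_Hf)(x,v)+\frac12a(x,v)[f(x,R_x^{\tilde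 U}v)-f(x,v)]$. $\mathcal{V}$ is the set of positive Schwartz functions, on which $\mathcal{L}'$ and all dual operators act; $\mathcal{L}$ and $\mathcal{L}^*$ act on $C_b^2$. $\mathbf{d}$ is the Fréchet derivative, $(\mathbf{d}\mathcal{S}(\rho),g)=\frac{d}{d\epsilon}\mathcal{S}(\rho+\epsilon g)|_{\epsilon=0}$, with $(\cdot,\cdot)$ the ($L^2$) duality pairing, and $\mathbf{d}_\xi$ is the Fréchet derivative in the second argument; $\mathbf{d}\mathcal{S}_{\hat V}(\rho)=\log\rho+1+\hat V+|v|^2/2$.
   Formalization: The potentials V and Ṽ are taken C¹, and the formula for L'ρ is stated for those ρ with a(x,v)ρ(x,v) integrable, since otherwise ψ̂* can be infinite at or near −dS(ρ)/2 and its derivative (in C_b² directions) is undefined. *)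

theory Defs
  imports "HOL-Analysis.Analysis"
begin

definition grad :: "('a::euclidean_space \<Rightarrow> real) \<Rightarrow> 'a \<Rightarrow> 'a" where
  "grad f x = (THE D. GDERIV f x :> D)"

text \<open>Iterated directional derivatives; the head of the list is differentiated last.
  With lists over the standard basis these are the iterated partial derivatives.\<close>

primrec pderivs :: "'b::euclidean_space list \<Rightarrow> ('b \<Rightarrow> real) \<Rightarrow> 'b \<Rightarrow> real" where
  "pderivs [] f = f"
| "pderivs (b # bs) f = (\<lambda>z. frechet_derivative (pderivs bs f) (at z) b)"

definition C1 :: "('b::euclidean_space \<Rightarrow> real) set" where
  "C1 = {f. (\<forall>x. f differentiable (at x)) \<and> continuous_on UNIV (grad f)}"

definition Cb2 :: "('b::euclidean_space \<Rightarrow> real) set" where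
  "Cb2 = {f. \<forall>bs \<in> lists Basis. length bs \<le> 2 \<longrightarrow>
      (length bs < 2 \<longrightarrow> (\<forall>z. pderivs bs f differentiable (at z)))
      \<and> continuous_on UNIV (pderivs bs f) \<and> bounded (range (pderivs bs f))}"

definition Cc2 :: "('b::euclidean_space \<Rightarrow> real) set" where
  "Cc2 = {f \<in> Cb2. compact (closure {z. f z \<noteq> 0})}"

definition schwartz :: "('b::euclidean_space \<Rightarrow> real) set" where
  "schwartz = {f. \<forall>bs \<in> lists Basis.
      (\<forall>z. pderivs bs f differentiable (at z))
      \<and> (\<forall>k::nat. bounded (range (\<lambda>z. norm z ^ k * pderivs bs f z)))}"

definition pos_schwartz :: "('b::euclidean_space \<Rightarrow> real) set" where
  "pos_schwartz = {f \<in> schwartz. \<forall>z. 0 < f z}"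

text \<open>The extended Lebesgue integral (positive part minus negative part), so that a functional
  given by a divergent integral of a nonnegative function has the value infinity.\<close>

definition ext_integral :: "('b::euclidean_space \<Rightarrow> real) \<Rightarrow> ereal" where
  "ext_integral f = enn2ereal (\<integral>\<^sup>+z. ennreal (f z) \<partial>lborel) - enn2ereal (\<integral>\<^sup>+z. ennreal (- f z) \<partial>lborel)"

text \<open>\<open>D\<close> represents, through the Lebesgue duality pairing, the derivative of \<open>F\<close> at \<open>\<xi>\<close> in all
  directions from \<open>G\<close>; the functional has to be finite along each direction near \<open>\<xi>\<close>.\<close>

definition has_frechet ::
    "('b::euclidean_space \<Rightarrow> real) set \<Rightarrow> (('b \<Rightarrow> real) \<Rightarrow> ereal) \<Rightarrow> ('b \<Rightarrow> real) \<Rightarrow> ('b \<Rightarrow> real) \<Rightarrow> bool" where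
  "has_frechet G F \<xi> D \<longleftrightarrow>
     (\<forall>g \<in> G. integrable lborel (\<lambda>z. D z * g z)
       \<and> (\<forall>\<^sub>F \<epsilon> in nhds (0::real). \<bar>F (\<lambda>z. \<xi> z + \<epsilon> * g z)\<bar> \<noteq> \<infinity>)
       \<and> ((\<lambda>\<epsilon>. real_of_ereal (F (\<lambda>z. \<xi> z + \<epsilon> * g z)))
            has_real_derivative (LINT z|lborel. D z * g z)) (at 0))"

text \<open>\<open>h\<close> is the value at \<open>g\<close> of the formal adjoint of \<open>T\<close> with respect to the measure with
  Lebesgue density \<open>w\<close>. Testing against \<open>Cc2\<close> determines \<open>h\<close> almost everywhere (for \<open>w > 0\<close>
  continuous), and the continuous representative is the one chosen.\<close>

definition is_formal_adjoint ::
    "('b::euclidean_space \<Rightarrow> real) \<Rightarrow> (('b \<Rightarrow> real) \<Rightarrow> 'b \<Rightarrow> real) \<Rightarrow> ('b \<Rightarrow> real) \<Rightarrow> ('b \<Rightarrow> real) \<Rightarrow> bool" where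
  "is_formal_adjoint w T g h \<longleftrightarrow> continuous_on UNIV h \<and>
     (\<forall>f \<in> Cc2. integrable lborel (\<lambda>z. T f z * g z * w z)
       \<and> integrable lborel (\<lambda>z. f z * h z * w z)
       \<and> (LINT z|lborel. T f z * g z * w z) = (LINT z|lborel. f z * h z * w z))"

definition formal_adjoint ::
    "('b::euclidean_space \<Rightarrow> real) \<Rightarrow> (('b \<Rightarrow> real) \<Rightarrow> 'b \<Rightarrow> real) \<Rightarrow> ('b \<Rightarrow> real) \<Rightarrow> 'b \<Rightarrow> real" where
  "formal_adjoint w T g = (THE h. is_formal_adjoint w T g h)"

definition gauss :: "'a::euclidean_space \<Rightarrow> real" where
  "gauss v = (2 * pi) powr (- (real DIM('a) / 2)) * exp (- (norm v)\<^sup>2 / 2)"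

definition mu :: "('a::euclidean_space \<Rightarrow> real) \<Rightarrow> 'a \<times> 'a \<Rightarrow> real" where
  "mu V = (\<lambda>(x, v). exp (- V x) * exp (- (norm v)\<^sup>2 / 2))"

text \<open>In the following definitions \<open>U\<close> stands for the difference of the two potentials.\<close>

definition rate :: "('a::euclidean_space \<Rightarrow> real) \<Rightarrow> 'a \<Rightarrow> 'a \<Rightarrow> real" where
  "rate U x v = v \<bullet> grad U x"

definition rate_pos :: "('a::euclidean_space \<Rightarrow> real) \<Rightarrow> 'a \<Rightarrow> 'a \<Rightarrow> real" where
  "rate_pos U x v = max (rate U x v) 0"

definition rate_neg :: "('a::euclidean_space \<Rightarrow> real) \<Rightarrow> 'a \<Rightarrow> 'a \<Rightarrow> real" where
  "rate_neg U x v = max (- rate U x v) 0"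

text \<open>Where the gradient vanishes this is the identity (division by zero gives zero);
  the rate is zero there.\<close>

definition reflect :: "('a::euclidean_space \<Rightarrow> real) \<Rightarrow> 'a \<Rightarrow> 'a \<Rightarrow> 'a" where
  "reflect U x v = v - (2 * (v \<bullet> grad U x) / (norm (grad U x))\<^sup>2) *\<^sub>R grad U x"

definition L_H :: "('a::euclidean_space \<Rightarrow> real) \<Rightarrow> ('a \<times> 'a \<Rightarrow> real) \<Rightarrow> 'a \<times> 'a \<Rightarrow> real" where
  "L_H Vt f = (\<lambda>(x, v). v \<bullet> grad (\<lambda>y. f (y, v)) x - grad Vt x \<bullet> grad (\<lambda>w. f (x, w)) v)"

definition L_Q :: "real \<Rightarrow> ('a::euclidean_space \<times> 'a \<Rightarrow> real) \<Rightarrow> 'a \<times> 'a \<Rightarrow> real" where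
  "L_Q lambda_r f = (\<lambda>(x, v). lambda_r * ((LINT w|lborel. f (x, w) * gauss w) - f (x, v)))"

definition L_R :: "('a::euclidean_space \<Rightarrow> real) \<Rightarrow> ('a \<times> 'a \<Rightarrow> real) \<Rightarrow> 'a \<times> 'a \<Rightarrow> real" where
  "L_R U f = (\<lambda>(x, v). rate_pos U x v * (f (x, reflect U x v) - f (x, v)))"

definition gen :: "('a::euclidean_space \<Rightarrow> real) \<Rightarrow> ('a \<Rightarrow> real) \<Rightarrow> real \<Rightarrow>
    ('a \<times> 'a \<Rightarrow> real) \<Rightarrow> 'a \<times> 'a \<Rightarrow> real" where
  "gen V Vt lambda_r f = (\<lambda>z. L_H Vt f z + L_Q lambda_r f z + L_R (\<lambda>x. V x - Vt x) f z)"

definition gen_star :: "('a::euclidean_space \<Rightarrow> real) \<Rightarrow> ('a \<Rightarrow> real) \<Rightarrow> real \<Rightarrow>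
    ('a \<times> 'a \<Rightarrow> real) \<Rightarrow> 'a \<times> 'a \<Rightarrow> real" where
  "gen_star V Vt lambda_r = formal_adjoint (mu V) (gen V Vt lambda_r)"

definition gen_A :: "('a::euclidean_space \<Rightarrow> real) \<Rightarrow> ('a \<Rightarrow> real) \<Rightarrow> real \<Rightarrow>
    ('a \<times> 'a \<Rightarrow> real) \<Rightarrow> 'a \<times> 'a \<Rightarrow> real" where
  "gen_A V Vt lambda_r f = (\<lambda>z. (gen V Vt lambda_r f z - gen_star V Vt lambda_r f z) / 2)"

definition gen' :: "('a::euclidean_space \<Rightarrow> real) \<Rightarrow> ('a \<Rightarrow> real) \<Rightarrow> real \<Rightarrow>
    ('a \<times> 'a \<Rightarrow> real) \<Rightarrow> 'a \<times> 'a \<Rightarrow> real" where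
  "gen' V Vt lambda_r = formal_adjoint (\<lambda>_. 1) (gen V Vt lambda_r)"

definition W_tilde :: "('a::euclidean_space \<Rightarrow> real) \<Rightarrow> ('a \<Rightarrow> real) \<Rightarrow> real \<Rightarrow>
    ('a \<times> 'a \<Rightarrow> real) \<Rightarrow> 'a \<times> 'a \<Rightarrow> real" where
  "W_tilde V Vt lambda_r = formal_adjoint (\<lambda>_. 1) (gen_A V Vt lambda_r)"

definition energy_term :: "('a::euclidean_space \<Rightarrow> real) \<Rightarrow> ('a \<times> 'a \<Rightarrow> real) \<Rightarrow> 'a \<times> 'a \<Rightarrow> real" where
  "energy_term Vh f = (\<lambda>(x, v). f (x, v) * (Vh x + (norm v)\<^sup>2 / 2))"

definition entropy :: "('a::euclidean_space \<Rightarrow> real) \<Rightarrow> ('a \<times> 'a \<Rightarrow> real) \<Rightarrow> ereal" where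
  "entropy Vh f = ext_integral (\<lambda>z. f z * ln (f z)) + ext_integral (energy_term Vh f)"

definition d_entropy :: "('a::euclidean_space \<Rightarrow> real) \<Rightarrow> ('a \<times> 'a \<Rightarrow> real) \<Rightarrow> 'a \<times> 'a \<Rightarrow> real" where
  "d_entropy Vh f = (\<lambda>(x, v). ln (f (x, v)) + 1 + Vh x + (norm v)\<^sup>2 / 2)"

definition psi :: "real \<Rightarrow> ('a::euclidean_space \<times> 'a \<Rightarrow> real) \<Rightarrow> ('a \<times> 'a \<Rightarrow> real) \<Rightarrow> ereal" where
  "psi lambda_r \<rho> \<xi> = ereal (lambda_r / (2 * pi) powr (real DIM('a) / 2)) *
     ext_integral (\<lambda>(x :: 'a, v :: 'a, v' :: 'a).
       (cosh (\<xi> (x, v') - \<xi> (x, v)) - 1) * exp (- ((norm v)\<^sup>2 + (norm v')\<^sup>2) / 4)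
         * sqrt (\<rho> (x, v) * \<rho> (x, v')))"

definition psi_hat :: "('a::euclidean_space \<Rightarrow> real) \<Rightarrow> ('a \<times> 'a \<Rightarrow> real) \<Rightarrow> ('a \<times> 'a \<Rightarrow> real) \<Rightarrow> ereal" where
  "psi_hat U \<rho> \<xi> = ereal (1 / 2) *
     ext_integral (\<lambda>(x, v). (rate_pos U x v + rate_neg U x v)
       * sqrt (\<rho> (x, reflect U x v) * \<rho> (x, v))
       * (cosh (\<xi> (x, reflect U x v) - \<xi> (x, v)) - 1))"

definition psi_tilde :: "('a::euclidean_space \<Rightarrow> real) \<Rightarrow> ('a \<Rightarrow> real) \<Rightarrow> real \<Rightarrow>
    ('a \<times> 'a \<Rightarrow> real) \<Rightarrow> ('a \<times> 'a \<Rightarrow> real) \<Rightarrow> ereal" where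
  "psi_tilde V Vt lambda_r \<rho> \<xi> = psi lambda_r \<rho> \<xi> + psi_hat (\<lambda>x. V x - Vt x) \<rho> \<xi>"

end

theory Submission
  imports Defs "HOL-Probability.Distributions"
begin

text \<open>The generator and both kinds of adjoint are computed explicitly, and the gradient structure is then
read off from the formulas. Write \<open>a\<close> for the rate, \<open>\<beta>\<close> for the reflection of the velocity as a map
of phase space (\<open>bounce\<close>) and \<open>\<gamma>\<close> for the Gaussian density.

Three symmetries give the adjoints (\<open>gen_dual\<close>). The Hamiltonian part differentiates along a
divergence free vector field, so it is antisymmetric for Lebesgue measure
(\<open>L_H_integration_by_parts\<close>). The map \<open>\<beta>\<close> is an involution that preserves Lebesgue measure and turns
\<open>a\<close> into \<open>- a\<close> (\<open>bounce_dual\<close>). Refreshment exchanges \<open>v\<close> with an independent Gaussian velocity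
(\<open>L_Q_dual\<close>). Hence the formal adjoint of the generator at \<open>\<rho>\<close> is
\<open>- L_H \<rho> + \<lambda> (\<gamma> \<integral>\<rho> dw - \<rho>) + a\<^sub>- \<rho>\<circ>\<beta> - a\<^sub>+ \<rho>\<close>. The adjoint with respect to \<open>\<mu>\<close> follows by
inserting \<open>\<rho> = g \<mu>\<close>: the flow conserves the energy for \<open>Vt\<close> and not that for \<open>V\<close>, so \<open>L_H \<mu> = - a \<mu>\<close>, which is exactly what
replaces \<open>a\<^sub>+\<close> by \<open>a\<^sub>-\<close> (\<open>fokker_planck_mu\<close>). The antisymmetric part has adjoint
\<open>- L_H \<rho> - a (\<rho>\<circ>\<beta> + \<rho>) / 2\<close>, and the difference of the two is the dissipative part
\<open>\<lambda> (\<gamma> \<integral>\<rho> dw - \<rho>) + \<bar>a\<bar> (\<rho>\<circ>\<beta> - \<rho>) / 2\<close> (\<open>fokker_planck_decomposition\<close>).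

It remains to recognise the dissipative part as the derivative of the potential. Both summands of
the potential integrate \<open>\<surd>(A B) (cosh (\<Delta>\<xi>) - 1)\<close>, where \<open>A\<close> is the flux of a jump, \<open>B\<close> the flux of
the reversed jump and \<open>\<Delta>\<xi>\<close> the increment of \<open>\<xi>\<close> along the jump. At minus half of the entropy
derivative this increment is \<open>(ln A - ln B) / 2\<close>: the potential \<open>Vh\<close> cancels because jumps do not move
\<open>x\<close>. The geometric mean then combines with the exponentials in \<open>cosh\<close> into \<open>A\<close> and \<open>B\<close> themselves
(\<open>sqrt_mult_cosh\<close>), so that along a bounded direction everything is integrable and the derivative is
the net flux \<open>A - B\<close> tested against the direction (\<open>reversible_jump_derivative\<close>). Positivity and
convexity come from \<open>cosh\<close>.\<close>

section \<open>Integration on Euclidean spaces\<close>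

lemma nn_integral_lborel_translate:
  fixes f :: "'b::euclidean_space \<Rightarrow> ennreal"
  assumes [measurable]: "f \<in> borel_measurable borel"
  shows "(\<integral>\<^sup>+x. f (x + c) \<partial>lborel) = (\<integral>\<^sup>+x. f x \<partial>lborel)"
proof -
  have "(\<integral>\<^sup>+x. f x \<partial>lborel) = (\<integral>\<^sup>+x. f x \<partial>distr lborel borel ((+) c))"
    by (simp add: lborel_distr_plus)
  also have "\<dots> = (\<integral>\<^sup>+x. f (c + x) \<partial>lborel)"
    by (rule nn_integral_distr) auto
  finally show ?thesis by (simp add: add.commute)
qed

text \<open>The uniqueness argument for Haar measure: integrate \<open>f (R x) g (y - R x)\<close> over \<open>x\<close> and \<open>y\<close>. Shifting
\<open>y\<close> gives the product of the integrals of \<open>f \<circ> R\<close> and \<open>g\<close>; shifting \<open>x\<close> first, by a vector whose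
image is \<open>y\<close>, gives that of \<open>f\<close> and \<open>g\<close>, provided that \<open>g\<close> depends on the norm only.\<close>

lemma nn_integral_lborel_orthogonal:
  fixes f :: "'b::euclidean_space \<Rightarrow> ennreal" and R :: "'b \<Rightarrow> 'b"
  assumes [measurable]: "f \<in> borel_measurable borel" and R: "orthogonal_transformation R"
  shows "(\<integral>\<^sup>+x. f (R x) \<partial>lborel) = (\<integral>\<^sup>+x. f x \<partial>lborel)"
proof -
  have lin: "linear R" and nR: "\<And>x. norm (R x) = norm x"
    using R by (auto simp: orthogonal_transformation_linear orthogonal_transformation_norm)
  have [measurable]: "R \<in> borel_measurable borel"
    by (rule borel_measurable_continuous_onI) (simp add: lin linear_continuous_on linear_conv_bounded_linear[symmetric])
  define g :: "'b \<Rightarrow> ennreal" where "g = indicator (cball 0 1)"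
  have [measurable]: "g \<in> borel_measurable borel" unfolding g_def by (intro borel_measurable_indicator) auto
  have g_cong: "norm x = norm y \<Longrightarrow> g x = g y" for x y
    by (simp add: g_def indicator_def)
  define E where "E = (\<integral>\<^sup>+x. g x \<partial>lborel)"
  have E: "E = emeasure lborel (cball (0::'b) 1)" by (simp add: E_def g_def)
  have E0: "E \<noteq> 0"
  proof
    assume "E = 0"
    then have "(cball (0::'b) 1) \<in> null_sets lborel" using E by auto
      then have "negligible (cball (0::'b) 1)" by (simp add: negligible_iff_null_sets null_sets_completionI)
    then show False by (simp add: negligible_convex_interior)
  qed
  have E1: "E \<noteq> \<infinity>"
    unfolding E using emeasure_lborel_cball_finite[of "0::'b" 1] by auto
  have "(\<integral>\<^sup>+x. f (R x) \<partial>lborel) * E = (\<integral>\<^sup>+x. f (R x) * E \<partial>lborel)"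
    by (simp add: nn_integral_multc)
  also have "\<dots> = (\<integral>\<^sup>+x. (\<integral>\<^sup>+y. f (R x) * g (y + (- R x)) \<partial>lborel) \<partial>lborel)"
    by (subst nn_integral_cmult) (simp_all add: E_def nn_integral_lborel_translate del: add_uminus_conv_diff)
  also have "\<dots> = (\<integral>\<^sup>+y. (\<integral>\<^sup>+x. f (R x) * g (y + (- R x)) \<partial>lborel) \<partial>lborel)"
    by (rule lborel_pair.Fubini'[symmetric]) simp
  also have "\<dots> = (\<integral>\<^sup>+y. (\<integral>\<^sup>+x. f (R x + y) * g x \<partial>lborel) \<partial>lborel)"
  proof (rule nn_integral_cong)
    fix y :: 'b
    obtain c where c: "R c = y" using orthogonal_transformation_surj[OF R] by (metis surjD)
    have "(\<integral>\<^sup>+x. f (R x) * g (y + (- R x)) \<partial>lborel) = (\<integral>\<^sup>+x. f (R (x + c)) * g (y + (- R (x + c))) \<partial>lborel)"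
      by (rule nn_integral_lborel_translate[symmetric]) measurable
    also have "\<dots> = (\<integral>\<^sup>+x. f (R x + y) * g x \<partial>lborel)"
      by (rule nn_integral_cong) (auto simp: linear_add[OF lin] c nR intro!: arg_cong2[where f="(*)"] g_cong)
    finally show "(\<integral>\<^sup>+x. f (R x) * g (y + (- R x)) \<partial>lborel) = (\<integral>\<^sup>+x. f (R x + y) * g x \<partial>lborel)" .
  qed
  also have "\<dots> = (\<integral>\<^sup>+x. (\<integral>\<^sup>+y. f (y + R x) * g x \<partial>lborel) \<partial>lborel)"
    by (subst lborel_pair.Fubini') (simp_all add: add.commute)
  also have "\<dots> = (\<integral>\<^sup>+x. (\<integral>\<^sup>+y. f y \<partial>lborel) * g x \<partial>lborel)"
    by (simp add: nn_integral_multc nn_integral_lborel_translate)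
  also have "\<dots> = (\<integral>\<^sup>+y. f y \<partial>lborel) * E"
    by (simp add: nn_integral_cmult E_def)
  finally show ?thesis
    using E0 E1 by (metis ennreal_mult_divide_eq infinity_ennreal_def)
qed

text \<open>Differentiation under the integral sign. The mean value theorem bounds the difference quotients by
\<open>B\<close>, and dominated convergence applies along every sequence that tends to zero.\<close>

lemma has_real_derivative_integral:
  fixes F F' :: "real \<Rightarrow> 'c \<Rightarrow> real"
  assumes d: "0 < d"
    and int: "\<And>t. \<bar>t\<bar> < d \<Longrightarrow> integrable M (F t)"
    and der: "\<And>t z. \<bar>t\<bar> < d \<Longrightarrow> z \<in> space M \<Longrightarrow> ((\<lambda>s. F s z) has_real_derivative F' t z) (at t)"
    and bnd: "\<And>t z. \<bar>t\<bar> < d \<Longrightarrow> z \<in> space M \<Longrightarrow> \<bar>F' t z\<bar> \<le> B z"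
    and B: "integrable M B"
  shows "integrable M (F' 0)"
    and "((\<lambda>t. LINT z|M. F t z) has_real_derivative (LINT z|M. F' 0 z)) (at 0)"
proof -
  have quot: "integrable M (F' 0) \<and> (\<lambda>n. ((LINT z|M. F (X n) z) - (LINT z|M. F 0 z)) / X n) \<longlonglongrightarrow> (LINT z|M. F' 0 z)"
    if X0: "\<And>n. X n \<noteq> 0" and Xd: "\<And>n. \<bar>X n\<bar> < d" and X: "X \<longlonglongrightarrow> 0" for X :: "nat \<Rightarrow> real"
  proof -
    define q where "q n z = (F (X n) z - F 0 z) / X n" for n z
    have qint: "integrable M (q n)" for n
      unfolding q_def using int Xd d by (intro integrable_divide_zero Bochner_Integration.integrable_diff) auto
    have q_lim: "(\<lambda>n. q n z) \<longlonglongrightarrow> F' 0 z" if "z \<in> space M" for z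
    proof -
      have "((\<lambda>h. (F (0 + h) z - F 0 z) / h) \<longlongrightarrow> F' 0 z) (at 0)"
        using der[of 0 z] that d unfolding DERIV_def by simp
      moreover have "filterlim X (at 0) sequentially"
        unfolding filterlim_at using X X0 by auto
      ultimately show ?thesis
        unfolding q_def using filterlim_compose[of "\<lambda>h. (F (0 + h) z - F 0 z) / h"] by force
    qed
    have q_bd: "norm (q n z) \<le> B z" if z: "z \<in> space M" for n z
    proof -
      have "\<exists>t. \<bar>t\<bar> < d \<and> F (X n) z - F 0 z = X n * F' t z"
      proof (cases "X n > 0")
        case True
        have "\<exists>t. 0 < t \<and> t < X n \<and> F (X n) z - F 0 z = (X n - 0) * F' t z"
          using True Xd[of n] by (intro MVT2 der z) auto
        then show ?thesis using Xd[of n] by force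
      next
        case False
        then have "X n < 0" using X0[of n] by simp
        then have "\<exists>t. X n < t \<and> t < 0 \<and> F 0 z - F (X n) z = (0 - X n) * F' t z"
          using Xd[of n] by (intro MVT2 der z) auto
        then obtain t where "X n < t" "t < 0" "F 0 z - F (X n) z = (0 - X n) * F' t z" by blast
        then show ?thesis using Xd[of n] by (intro exI[of _ t]) auto
      qed
      then obtain t where "\<bar>t\<bar> < d" "q n z = F' t z" using X0[of n] by (auto simp: q_def)
      then show ?thesis using bnd[of t z] z by simp
    qed
    have meas: "F' 0 \<in> borel_measurable M"
      by (rule borel_measurable_LIMSEQ_real[where u=q]) (use q_lim qint in auto)
    have "integrable M (F' 0)"
      by (rule integrable_dominated_convergence[where s=q and w=B]) (use q_lim qint q_bd B meas in auto)
    moreover have "(\<lambda>n. LINT z|M. q n z) \<longlonglongrightarrow> (LINT z|M. F' 0 z)"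
      by (rule integral_dominated_convergence[where w=B]) (use q_lim qint q_bd B meas in auto)
    moreover have "(LINT z|M. q n z) = ((LINT z|M. F (X n) z) - (LINT z|M. F 0 z)) / X n" for n
      unfolding q_def using int[OF Xd] int[of 0] d by simp
    ultimately show ?thesis by simp
  qed
  show "integrable M (F' 0)"
  proof -
    have 1: "(\<lambda>n. d / 2 * inverse (real (Suc n))) \<longlonglongrightarrow> d / 2 * 0"
      by (intro tendsto_mult tendsto_const LIMSEQ_inverse_real_of_nat)
    have 2: "\<bar>d / 2 * inverse (real (Suc n))\<bar> < d" for n
    proof -
      have "inverse (real (Suc n)) \<le> 1" by (simp add: field_simps)
      then have "d / 2 * inverse (real (Suc n)) \<le> d / 2 * 1" using d by (intro mult_left_mono) auto
      then show ?thesis using d by (simp add: abs_mult)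
    qed
    show ?thesis using quot[of "\<lambda>n. d / 2 * inverse (real (Suc n))"] 1 2 d by auto
  qed
  have "((\<lambda>h. ((LINT z|M. F h z) - (LINT z|M. F 0 z)) / h) \<longlongrightarrow> (LINT z|M. F' 0 z)) (at 0 within {-d<..<d})"
    unfolding tendsto_at_iff_sequentially comp_def
  proof (intro allI impI)
    fix X :: "nat \<Rightarrow> real"
    assume "\<forall>i. X i \<in> {-d<..<d} - {0}" and lim: "X \<longlonglongrightarrow> 0"
    then have "X i \<noteq> 0" "\<bar>X i\<bar> < d" for i by (auto simp: abs_less_iff dest: spec[of _ i])
    from quot[OF this lim]
    show "(\<lambda>n. ((LINT z|M. F (X n) z) - (LINT z|M. F 0 z)) / X n) \<longlonglongrightarrow> (LINT z|M. F' 0 z)" by blast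
  qed
  moreover have "at 0 within {-d<..<d} = at 0" using d by (intro at_within_open) auto
  ultimately show "((\<lambda>t. LINT z|M. F t z) has_real_derivative (LINT z|M. F' 0 z)) (at 0)"
    unfolding DERIV_def by simp
qed

lemma continuous_on_parametric_integral:
  fixes F :: "'b::metric_space \<Rightarrow> 'c \<Rightarrow> real"
  assumes "\<And>x. F x \<in> borel_measurable M" and "integrable M B"
    and "\<And>x z. \<bar>F x z\<bar> \<le> B z" and "\<And>z. continuous_on UNIV (\<lambda>x. F x z)"
  shows "continuous_on UNIV (\<lambda>x. LINT z|M. F x z)"
  unfolding continuous_on_sequentially comp_def
proof (intro allI ballI impI)
  fix X :: "nat \<Rightarrow> 'b" and x assume X: "x \<in> UNIV" "(\<forall>n. X n \<in> UNIV) \<and> X \<longlonglongrightarrow> x"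
  show "(\<lambda>n. LINT z|M. F (X n) z) \<longlonglongrightarrow> (LINT z|M. F x z)"
  proof (rule integral_dominated_convergence[where w=B])
    show "AE z in M. (\<lambda>i. F (X i) z) \<longlonglongrightarrow> F x z"
      using assms(4) X unfolding continuous_on_sequentially comp_def by auto
  qed (use assms in auto)
qed

lemma integrable_compact_support:
  fixes f :: "'b::euclidean_space \<Rightarrow> real"
  assumes "continuous_on UNIV f" "compact K" "\<And>z. z \<notin> K \<Longrightarrow> f z = 0"
  shows "integrable lborel f"
proof -
  have "integrable lborel (\<lambda>x. indicator K x *\<^sub>R f x)"
    using assms by (intro borel_integrable_compact) (auto intro: continuous_on_subset)
  moreover have "(\<lambda>x. indicator K x *\<^sub>R f x) = f" using assms(3) by (auto simp: indicator_def fun_eq_iff)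
  ultimately show ?thesis by simp
qed

text \<open>The function is at most the sum of the indicators of the balls of radius \<open>n + 1\<close> with weights
\<open>C / (n + 1) ^ (d + 2)\<close>. Since volumes grow like \<open>n ^ d\<close>, the series of \<open>1 / n ^ 2\<close> remains.\<close>

lemma integrable_polynomial_decay:
  fixes f :: "'b::euclidean_space \<Rightarrow> real"
  assumes [measurable]: "f \<in> borel_measurable borel"
    and bd: "\<And>z. \<bar>f z\<bar> * (1 + norm z) ^ (DIM('b) + 2) \<le> C"
  shows "integrable lborel f"
proof (rule integrableI_bounded)
  define d where "d = DIM('b)"
  have C: "0 \<le> C" using order_trans[OF _ bd[of 0]] by auto
  define c where "c n = C / real (Suc n) ^ (d + 2)" for n
  have pt: "ennreal (norm (f z)) \<le> (\<Sum>n. ennreal (c n) * indicator (cball 0 (real (Suc n))) z)" for z :: 'b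
  proof -
    define n where "n = nat \<lfloor>norm z\<rfloor>"
    have n1: "real n \<le> norm z" "norm z \<le> real (Suc n)"
      using floor_correct[of "norm z"] norm_ge_zero[of z] real_of_int_floor_add_one_ge[of "norm z"] unfolding n_def by (auto simp: of_nat_nat add.commute simp del: norm_ge_zero)
    have "\<bar>f z\<bar> * real (Suc n) ^ (d + 2) \<le> \<bar>f z\<bar> * (1 + norm z) ^ (d + 2)"
      using n1 by (intro mult_left_mono power_mono) auto
    also have "\<dots> \<le> C" using bd[of z] by (simp add: d_def)
    finally have "\<bar>f z\<bar> \<le> c n" unfolding c_def by (simp add: pos_le_divide_eq)
    then have "ennreal (norm (f z)) \<le> ennreal (c n) * indicator (cball 0 (real (Suc n))) z"
      using n1 by (simp add: ennreal_leI)
    also have "\<dots> \<le> (\<Sum>n. ennreal (c n) * indicator (cball 0 (real (Suc n))) z)"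
    proof -
      have "h n \<le> (\<Sum>n. h n)" for h :: "nat \<Rightarrow> ennreal"
        using sum_le_suminf[OF summableI, of "{n}" h] by simp
      then show ?thesis .
    qed
    finally show ?thesis .
  qed
  have [measurable]: "cball (0::'b) r \<in> sets borel" for r by (simp add: borel_closed)
  have vol: "emeasure lborel (cball (0::'b) (real (Suc n))) = ennreal (unit_ball_vol (real d) * real (Suc n) ^ d)" for n
    unfolding d_def by (rule emeasure_cball) simp
  have "(\<integral>\<^sup>+z. ennreal (norm (f z)) \<partial>lborel) \<le> (\<integral>\<^sup>+z. (\<Sum>n. ennreal (c n) * indicator (cball 0 (real (Suc n))) (z::'b)) \<partial>lborel)"
    by (intro nn_integral_mono pt)
  also have "\<dots> = (\<Sum>n. ennreal (c n) * emeasure lborel (cball (0::'b) (real (Suc n))))"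
    by (subst nn_integral_suminf) (simp_all add: nn_integral_cmult_indicator)
  also have "\<dots> = (\<Sum>n. ennreal (C * unit_ball_vol (real d) * inverse (real (Suc n) ^ 2)))"
  proof (rule suminf_cong)
    fix n
    have "c n * (unit_ball_vol (real d) * real (Suc n) ^ d) = C * unit_ball_vol (real d) * inverse (real (Suc n) ^ 2)"
      unfolding c_def power_add by (simp add: field_simps)
    then show "ennreal (c n) * emeasure lborel (cball (0::'b) (real (Suc n))) = ennreal (C * unit_ball_vol (real d) * inverse (real (Suc n) ^ 2))"
      unfolding vol using C by (subst ennreal_mult[symmetric]) (auto simp: c_def unit_ball_vol_nonneg simp del: of_nat_Suc)
  qed
  also have "\<dots> < \<infinity>"
  proof -
    have "summable (\<lambda>n. inverse (real (Suc n) ^ 2))"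
      using inverse_power_summable[of 2, where 'a=real] summable_Suc_iff[of "\<lambda>n. inverse (real n ^ 2)"] by simp
    then have "summable (\<lambda>n. C * unit_ball_vol (real d) * inverse (real (Suc n) ^ 2))"
      by (intro summable_mult)
    then have "(\<Sum>n. ennreal (C * unit_ball_vol (real d) * inverse (real (Suc n) ^ 2))) \<noteq> top"
      by (intro ennreal_suminf_neq_top) (auto simp: C unit_ball_vol_nonneg)
    then show ?thesis by (simp add: less_top)
  qed
  finally show "(\<integral>\<^sup>+z. ennreal (norm (f z)) \<partial>lborel) < \<infinity>" .
qed simp

lemma nn_integral_gauss: "(\<integral>\<^sup>+v. ennreal (gauss (v::'a::euclidean_space)) \<partial>lborel) = 1"
proof -
  have "gauss v = (\<Prod>b\<in>Basis. std_normal_density (v \<bullet> b))" for v :: 'a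
  proof -
    have "(\<Prod>b\<in>Basis. std_normal_density (v \<bullet> b)) = (1 / sqrt (2 * pi)) ^ DIM('a) * exp (\<Sum>b\<in>Basis. - (v \<bullet> b)\<^sup>2 / 2)"
      by (simp add: std_normal_density_def prod.distrib exp_sum prod_dividef power_divide)
    moreover have "(\<Sum>b\<in>Basis. - (v \<bullet> b)\<^sup>2 / 2) = - (norm v)\<^sup>2 / 2"
      unfolding power2_norm_eq_inner euclidean_inner[of v v] by (simp add: sum_divide_distrib sum_negf power2_eq_square)
    moreover have "(1 / sqrt (2 * pi)) ^ DIM('a) = (2 * pi) powr (- (real DIM('a) / 2))"
      by (simp add: powr_half_sqrt[symmetric] powr_minus powr_realpow[symmetric] powr_powr field_simps powr_divide del: powr_realpow)
    ultimately show ?thesis by (simp add: gauss_def)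
  qed
  then have "(\<integral>\<^sup>+v. ennreal (gauss (v::'a)) \<partial>lborel) = (\<integral>\<^sup>+v. (\<Prod>b\<in>Basis. ennreal (std_normal_density ((v::'a) \<bullet> b))) \<partial>lborel)"
    by (simp add: prod_ennreal)
  also have "\<dots> = (\<Prod>b\<in>(Basis::'a set). \<integral>\<^sup>+x. ennreal (std_normal_density x) \<partial>lborel)"
    by (rule nn_integral_lborel_prod) auto
  also have "(\<integral>\<^sup>+x. ennreal (std_normal_density x) \<partial>lborel) = 1"
    by (simp add: nn_integral_eq_integral integrable_normal_density integral_normal_density)
  finally show ?thesis by simp
qed

lemma borel_measurable_fst_snd [measurable]:
  "(fst :: 'b::euclidean_space \<times> 'c::euclidean_space \<Rightarrow> 'b) \<in> borel_measurable borel"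
  "(snd :: 'b::euclidean_space \<times> 'c::euclidean_space \<Rightarrow> 'c) \<in> borel_measurable borel"
  by (auto intro!: borel_measurable_continuous_onI continuous_intros)

lemma nn_integral_lborel_pair:
  fixes f :: "'b::euclidean_space \<times> 'c::euclidean_space \<Rightarrow> ennreal"
  assumes "f \<in> borel_measurable borel"
  shows "(\<integral>\<^sup>+z. f z \<partial>lborel) = (\<integral>\<^sup>+x. (\<integral>\<^sup>+y. f (x, y) \<partial>lborel) \<partial>lborel)"
  using lborel.nn_integral_fst[of f lborel] assms by (simp add: lborel_prod borel_prod)

lemma lborel_distr_eqI:
  fixes T :: "'b::euclidean_space \<Rightarrow> 'c::euclidean_space"
  assumes [measurable]: "T \<in> borel_measurable borel"
    and "\<And>f::'c \<Rightarrow> ennreal. f \<in> borel_measurable borel \<Longrightarrow> (\<integral>\<^sup>+z. f (T z) \<partial>lborel) = (\<integral>\<^sup>+z. f z \<partial>lborel)"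
  shows "distr lborel borel T = lborel"
proof (rule measure_eqI)
  fix A assume "A \<in> sets (distr lborel borel T)"
  then have [measurable]: "A \<in> sets borel" by simp
  have "emeasure (distr lborel borel T) A = (\<integral>\<^sup>+z. indicator A z \<partial>distr lborel borel T)"
    by (rule nn_integral_indicator[symmetric]) simp
  also have "\<dots> = (\<integral>\<^sup>+z. indicator A (T z) \<partial>lborel)"
    by (rule nn_integral_distr) auto
  also have "\<dots> = emeasure lborel A"
    by (subst assms(2)) auto
  finally show "emeasure (distr lborel borel T) A = emeasure lborel A" .
qed simp

lemma lborel_preserving_integral:
  fixes T :: "'b::euclidean_space \<Rightarrow> 'c::euclidean_space" and f :: "'c \<Rightarrow> real"
  assumes "distr lborel borel T = lborel" and [measurable]: "T \<in> borel_measurable borel"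
    and int: "integrable lborel f"
  shows "integrable lborel (\<lambda>z. f (T z))" and "(LINT z|lborel. f (T z)) = (LINT z|lborel. f z)"
proof -
  have [measurable]: "f \<in> borel_measurable borel" using borel_measurable_integrable[OF int] by simp
  show "integrable lborel (\<lambda>z. f (T z))"
    using int integrable_distr_eq[of T lborel borel f] assms(1) by simp
  show "(LINT z|lborel. f (T z)) = (LINT z|lborel. f z)"
    using integral_distr[of T lborel borel f] assms(1) by simp
qed

lemma integrable_mult_bounded:
  fixes X b :: "'b::euclidean_space \<Rightarrow> real"
  assumes X: "integrable lborel X" and [measurable]: "b \<in> borel_measurable borel" and b: "\<And>z. \<bar>b z\<bar> \<le> c"
  shows "integrable lborel (\<lambda>z. X z * b z)"
proof (rule Bochner_Integration.integrable_bound)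
  show "integrable lborel (\<lambda>z. X z * c)" using X by simp
  have [measurable]: "X \<in> borel_measurable borel" using borel_measurable_integrable[OF X] by simp
  show "(\<lambda>z. X z * b z) \<in> borel_measurable lborel" by simp
  show "AE z in lborel. norm (X z * b z) \<le> norm (X z * c)"
    using b by (auto intro!: AE_I2 mult_left_mono simp: abs_mult intro: order_trans[OF _ abs_ge_self])
qed

section \<open>Reflection of the velocity\<close>

lemma reflect_inner_grad: "reflect U x v \<bullet> grad U x = - (v \<bullet> grad U x)"
  by (cases "grad U x = 0") (auto simp: reflect_def inner_diff_left power2_norm_eq_inner)

lemma rate_reflect: "rate U x (reflect U x v) = - rate U x v"
  by (simp add: rate_def reflect_inner_grad)

lemma reflect_reflect [simp]: "reflect U x (reflect U x v) = v"
  by (subst reflect_def) (simp add: reflect_inner_grad, simp add: reflect_def)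

lemma orthogonal_transformation_reflect: "orthogonal_transformation (reflect U x)"
  unfolding orthogonal_transformation_def
proof
  show "linear (reflect U x)"
    by (rule linearI) (simp_all add: reflect_def inner_add_left algebra_simps add_divide_distrib)
  have "reflect U x v \<bullet> reflect U x w = v \<bullet> w" for v w
  proof -
    have "reflect U x v \<bullet> reflect U x w = v \<bullet> reflect U x w - (2 * (v \<bullet> grad U x) / (norm (grad U x))\<^sup>2) * (reflect U x w \<bullet> grad U x)"
      by (simp add: reflect_def[of U x v] inner_diff_left) (simp add: inner_commute)
    also have "\<dots> = v \<bullet> w"
      unfolding reflect_inner_grad by (simp add: reflect_def inner_diff_right)
    finally show ?thesis .
  qed
  then show "\<forall>v w. reflect U x v \<bullet> reflect U x w = v \<bullet> w" by blast
qed

lemma norm_reflect [simp]: "norm (reflect U x v) = norm v"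
  by (rule orthogonal_transformation_norm[OF orthogonal_transformation_reflect])

definition bounce :: "('a::euclidean_space \<Rightarrow> real) \<Rightarrow> 'a \<times> 'a \<Rightarrow> 'a \<times> 'a" where
  "bounce U z = (fst z, reflect U (fst z) (snd z))"

lemma bounce_bounce [simp]: "bounce U (bounce U z) = z"
  by (simp add: bounce_def)

lemma borel_measurable_bounce:
  assumes "U \<in> C1"
  shows "bounce U \<in> borel_measurable borel"
proof -
  have [measurable]: "grad U \<in> borel_measurable borel"
    using assms by (auto simp: C1_def intro: borel_measurable_continuous_onI)
  have "(\<lambda>z. (fst z, reflect U (fst z) (snd z))) \<in> borel_measurable borel"
    unfolding borel_prod[symmetric] reflect_def by measurable
  then show ?thesis by (simp add: bounce_def[abs_def])
qed

lemma lborel_distr_bounce: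
  assumes "U \<in> C1"
  shows "distr lborel borel (bounce U) = lborel"
proof (rule lborel_distr_eqI[OF borel_measurable_bounce[OF assms]])
  fix f :: "'a \<times> 'a \<Rightarrow> ennreal" assume [measurable]: "f \<in> borel_measurable borel"
  note [measurable] = borel_measurable_bounce[OF assms]
  have fx: "(\<lambda>v. f (x, v)) \<in> borel_measurable borel" for x
    by (rule measurable_compose[OF _ \<open>f \<in> _\<close>]) (auto intro!: borel_measurable_continuous_onI continuous_intros)
  have "(\<integral>\<^sup>+z. f (bounce U z) \<partial>lborel) = (\<integral>\<^sup>+x. \<integral>\<^sup>+v. f (x, reflect U x v) \<partial>lborel \<partial>lborel)"
    using nn_integral_lborel_pair[OF measurable_compose[OF borel_measurable_bounce[OF assms] \<open>f \<in> _\<close>]]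
    by (simp add: bounce_def)
  also have "\<dots> = (\<integral>\<^sup>+x. \<integral>\<^sup>+v. f (x, v) \<partial>lborel \<partial>lborel)"
    by (intro nn_integral_cong nn_integral_lborel_orthogonal[OF fx] orthogonal_transformation_reflect)
  finally show "(\<integral>\<^sup>+z. f (bounce U z) \<partial>lborel) = (\<integral>\<^sup>+z. f z \<partial>lborel)"
    by (simp add: nn_integral_lborel_pair)
qed

lemma bounce_integral:
  fixes f :: "'a::euclidean_space \<times> 'a \<Rightarrow> real"
  assumes "U \<in> C1" "integrable lborel f"
  shows "integrable lborel (\<lambda>z. f (bounce U z))" "(LINT z|lborel. f (bounce U z)) = (LINT z|lborel. f z)"
  using lborel_preserving_integral[OF lborel_distr_bounce borel_measurable_bounce] assms by blast+

section \<open>Exchanging a velocity with a Gaussian one\<close>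

lemma gauss_nonneg: "0 \<le> gauss v" and gauss_pos: "0 < gauss v"
  by (auto simp: gauss_def)

lemma continuous_on_gauss: "continuous_on S gauss"
  unfolding gauss_def[abs_def] by (intro continuous_intros) auto

lemma borel_measurable_gauss [measurable]: "gauss \<in> borel_measurable borel"
  by (intro borel_measurable_continuous_onI continuous_on_gauss)

lemma integrable_gauss: "integrable lborel (gauss :: 'a::euclidean_space \<Rightarrow> real)"
  by (rule integrableI_nonneg) (auto simp: nn_integral_gauss gauss_nonneg)

lemma integral_gauss: "(LINT v|lborel. gauss (v::'a::euclidean_space)) = 1"
  by (rule integral_eq_nn_integral[THEN trans]) (auto simp: nn_integral_gauss gauss_nonneg)

lemma lborel_distr_assoc:
  "distr lborel borel (\<lambda>y::('b::euclidean_space \<times> 'c::euclidean_space) \<times> 'd::euclidean_space. (fst (fst y), snd (fst y), snd y)) = lborel"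
proof (rule lborel_distr_eqI)
  show m[measurable]: "(\<lambda>y::('b \<times> 'c) \<times> 'd. (fst (fst y), snd (fst y), snd y)) \<in> borel_measurable borel"
    by (intro borel_measurable_continuous_onI continuous_intros)
  fix f :: "'b \<times> 'c \<times> 'd \<Rightarrow> ennreal" assume [measurable]: "f \<in> borel_measurable borel"
  have fx: "(\<lambda>v. f (x, v)) \<in> borel_measurable borel" for x
    by (rule measurable_compose[OF _ \<open>f \<in> _\<close>]) (auto intro!: borel_measurable_continuous_onI continuous_intros)
  have m2: "(\<lambda>z. \<integral>\<^sup>+v. f (fst z, snd z, v) \<partial>lborel) \<in> borel_measurable borel"
  proof -
    have "(\<lambda>(z, v). f (fst z, snd z, v)) \<in> borel_measurable (borel \<Otimes>\<^sub>M lborel)"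
      using measurable_compose[OF m \<open>f \<in> _\<close>] by (simp add: borel_prod case_prod_beta')
    then show ?thesis
      by (intro lborel.borel_measurable_nn_integral) auto
  qed
  show "(\<integral>\<^sup>+y. f (fst (fst y), snd (fst y), snd y) \<partial>lborel) = (\<integral>\<^sup>+z. f z \<partial>lborel)"
    by (simp add: nn_integral_lborel_pair fx m2)
qed

lemma lborel_distr_swap_velocities:
  "distr lborel borel (\<lambda>y::'a::euclidean_space \<times> 'a \<times> 'a. (fst y, snd (snd y), fst (snd y))) = lborel"
proof (rule lborel_distr_eqI)
  show m[measurable]: "(\<lambda>y::'a \<times> 'a \<times> 'a. (fst y, snd (snd y), fst (snd y))) \<in> borel_measurable borel"
    by (intro borel_measurable_continuous_onI continuous_intros)
  fix f :: "'a \<times> 'a \<times> 'a \<Rightarrow> ennreal" assume [measurable]: "f \<in> borel_measurable borel"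
  have fx: "(\<lambda>v. f (x, v)) \<in> borel_measurable borel" for x
    by (rule measurable_compose[OF _ \<open>f \<in> _\<close>]) (auto intro!: borel_measurable_continuous_onI continuous_intros)
  have fs: "(\<lambda>v. f (x, snd v, fst v)) \<in> borel_measurable borel" for x
    by (rule measurable_compose[OF _ \<open>f \<in> _\<close>]) (auto intro!: borel_measurable_continuous_onI continuous_intros)
  have "(\<integral>\<^sup>+y. f (fst y, snd (snd y), fst (snd y)) \<partial>lborel) = (\<integral>\<^sup>+x. \<integral>\<^sup>+v. \<integral>\<^sup>+w. f (x, w, v) \<partial>lborel \<partial>lborel \<partial>lborel)"
    by (simp add: nn_integral_lborel_pair fs)
  also have "\<dots> = (\<integral>\<^sup>+x. \<integral>\<^sup>+w. \<integral>\<^sup>+v. f (x, w, v) \<partial>lborel \<partial>lborel \<partial>lborel)"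
    by (intro nn_integral_cong lborel_pair.Fubini') (use fx in \<open>simp add: lborel_prod case_prod_beta'\<close>)
  finally show "(\<integral>\<^sup>+y. f (fst y, snd (snd y), fst (snd y)) \<partial>lborel) = (\<integral>\<^sup>+z. f z \<partial>lborel)"
    by (simp add: nn_integral_lborel_pair fx)
qed

lemma integral_lborel_pair:
  fixes f :: "'b::euclidean_space \<times> 'c::euclidean_space \<Rightarrow> real"
  assumes "integrable lborel f"
  shows "integrable lborel (\<lambda>x. LINT y|lborel. f (x, y))"
    and "(LINT x|lborel. LINT y|lborel. f (x, y)) = (LINT z|lborel. f z)"
  using lborel_pair.integrable_fst'[of f] lborel_pair.integral_fst'[of f] assms
  by (simp_all add: lborel_prod)

lemma integrable_lborel_times:
  fixes f :: "'b::euclidean_space \<Rightarrow> real" and g :: "'c::euclidean_space \<Rightarrow> real"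
  assumes f: "integrable lborel f" and g: "integrable lborel g"
  shows "integrable lborel (\<lambda>z. f (fst z) * g (snd z))"
proof -
  have [measurable]: "f \<in> borel_measurable borel" "g \<in> borel_measurable borel"
    using f g borel_measurable_integrable by force+
  have "integrable (lborel \<Otimes>\<^sub>M lborel) (\<lambda>z. f (fst z) * g (snd z))"
  proof (rule lborel_pair.Fubini_integrable)
    show "integrable lborel (\<lambda>x. LINT y|lborel. norm (f (fst (x, y)) * g (snd (x, y))))"
      using f g by (simp add: abs_mult)
    show "AE x in lborel. integrable lborel (\<lambda>y. f (fst (x, y)) * g (snd (x, y)))"
      using g by simp
  qed simp
  then show ?thesis by (simp add: lborel_prod)
qed

text \<open>The detailed balance of velocity refreshment. Both iterated integrals come from the same function
\<open>F\<close> of \<open>(x, v, v')\<close>: in one the Gaussian velocity \<open>v'\<close> is integrated first, in the other the two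
velocities have changed places and the original velocity is integrated first.\<close>

lemma triple_integral:
  fixes G :: "'a::euclidean_space \<times> 'a \<Rightarrow> real" and b :: "'a \<times> 'a \<times> 'a \<Rightarrow> real"
  assumes G: "integrable lborel G" and b[measurable]: "b \<in> borel_measurable borel"
    and bd: "\<And>y. \<bar>b y\<bar> \<le> C"
  defines "F \<equiv> \<lambda>y. G (fst y, fst (snd y)) * gauss (snd (snd y)) * b y"
  shows "integrable lborel F"
    and "(LINT z|lborel. G z * (LINT w|lborel. gauss w * b (fst z, snd z, w))) = (LINT y|lborel. F y)"
    and "integrable lborel (\<lambda>z. G z * (LINT w|lborel. gauss w * b (fst z, snd z, w)))"
    and "(LINT z|lborel. gauss (snd z) * (LINT w|lborel. G (fst z, w) * b (fst z, w, snd z))) = (LINT y|lborel. F y)"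
    and "integrable lborel (\<lambda>z. gauss (snd z) * (LINT w|lborel. G (fst z, w) * b (fst z, w, snd z)))"
proof -
  have [measurable]: "G \<in> borel_measurable borel" using borel_measurable_integrable[OF G] by simp
  define A where "A = (\<lambda>y::('a \<times> 'a) \<times> 'a. (fst (fst y), snd (fst y), snd y))"
  define A' where "A' = (\<lambda>y::'a \<times> 'a \<times> 'a. ((fst y, fst (snd y)), snd (snd y)))"
  define S where "S = (\<lambda>y::'a \<times> 'a \<times> 'a. (fst y, snd (snd y), fst (snd y)))"
  have [measurable]: "A \<in> borel_measurable borel" "A' \<in> borel_measurable borel" "S \<in> borel_measurable borel"
    unfolding A_def A'_def S_def by (auto intro!: borel_measurable_continuous_onI continuous_intros)
  have dA: "distr lborel borel A = lborel" and dS: "distr lborel borel S = lborel"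
    unfolding A_def S_def by (rule lborel_distr_assoc lborel_distr_swap_velocities)+
  have dA': "distr lborel borel A' = lborel"
  proof -
    have "distr lborel borel A' = distr (distr lborel borel A) borel A'" by (simp add: dA)
    also have "\<dots> = distr lborel borel (A' \<circ> A)" by (rule distr_distr) auto
    also have "A' \<circ> A = id" by (auto simp: A_def A'_def)
    finally show ?thesis by (simp add: distr_id2)
  qed
  define F0 where "F0 = (\<lambda>y::('a\<times>'a)\<times>'a. G (fst y) * gauss (snd y) * b (A y))"
  have F0_A': "F0 (A' y) = F y" for y by (simp add: F0_def A'_def A_def F_def)
  have int0: "integrable lborel F0"
    unfolding F0_def
    by (rule integrable_mult_bounded[OF integrable_lborel_times[OF G integrable_gauss] _ bd]) measurable
  show intF: "integrable lborel F"
    using lborel_preserving_integral(1)[OF dA' _ int0] by (simp add: F0_A')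
  have F_F0: "(LINT y|lborel. F y) = (LINT y|lborel. F0 y)"
    using lborel_preserving_integral(2)[OF dA' _ int0] by (simp add: F0_A')
  show "(LINT z|lborel. G z * (LINT w|lborel. gauss w * b (fst z, snd z, w))) = (LINT y|lborel. F y)"
    "integrable lborel (\<lambda>z. G z * (LINT w|lborel. gauss w * b (fst z, snd z, w)))"
    using integral_lborel_pair[OF int0] by (simp_all add: F_F0 F0_def A_def mult.assoc)
  \<comment> \<open>Exchange the velocities before integrating out the last one.\<close>
  define F1 where "F1 = (\<lambda>y::('a\<times>'a)\<times>'a. F (S (A y)))"
  have int1: "integrable lborel F1"
    using lborel_preserving_integral(1)[OF dA _ lborel_preserving_integral(1)[OF dS _ intF]] by (simp add: F1_def)
  have F_F1: "(LINT y|lborel. F1 y) = (LINT y|lborel. F y)"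
    using lborel_preserving_integral(2)[OF dA _ lborel_preserving_integral(1)[OF dS _ intF]]
      lborel_preserving_integral(2)[OF dS _ intF] by (simp add: F1_def)
  have "F1 (z, w) = gauss (snd z) * (G (fst z, w) * b (fst z, w, snd z))" for z w
    by (simp add: F1_def F_def S_def A_def)
  then show "(LINT z|lborel. gauss (snd z) * (LINT w|lborel. G (fst z, w) * b (fst z, w, snd z))) = (LINT y|lborel. F y)"
    "integrable lborel (\<lambda>z. gauss (snd z) * (LINT w|lborel. G (fst z, w) * b (fst z, w, snd z)))"
    using integral_lborel_pair[OF int1] by (simp_all add: F_F1)
qed

section \<open>Gradients and integration by parts\<close>

lemma has_derivative_grad:
  assumes "f differentiable (at x)"
  shows "(f has_derivative (\<lambda>h. h \<bullet> grad f x)) (at x)"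
proof -
  obtain f' where f': "(f has_derivative f') (at x)" using assms by (auto simp: differentiable_def)
  then have lin: "linear f'" using has_derivative_linear by blast
  define D where "D = (\<Sum>b\<in>Basis. f' b *\<^sub>R b)"
  have "f' h = h \<bullet> D" for h
  proof -
    have "f' h = f' (\<Sum>b\<in>Basis. (h \<bullet> b) *\<^sub>R b)" by (simp add: euclidean_representation)
    also have "\<dots> = (\<Sum>b\<in>Basis. (h \<bullet> b) * f' b)"
      by (simp add: linear_sum[OF lin] linear_scale[OF lin])
    also have "\<dots> = h \<bullet> D" by (simp add: D_def inner_sum_right mult.commute)
    finally show ?thesis .
  qed
  then have "f' = (\<lambda>h. h \<bullet> D)" by auto
  then have D: "GDERIV f x :> D" using f' by (simp add: gderiv_def)
  have "E = D" if "GDERIV f x :> E" for E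
  proof -
    have "(\<lambda>h. h \<bullet> E) = (\<lambda>h. h \<bullet> D)"
      using that D has_derivative_unique unfolding gderiv_def by blast
    then have "h \<bullet> E = h \<bullet> D" for h by (rule fun_cong)
    then show ?thesis using vector_eq_ldot by blast
  qed
  with D have "grad f x = D" unfolding grad_def by (rule the_equality)
  then show ?thesis using D by (simp add: gderiv_def)
qed

lemma grad_eqI:
  assumes "(f has_derivative (\<lambda>h. h \<bullet> D)) (at x)"
  shows "grad f x = D"
proof -
  have "(\<lambda>h. h \<bullet> grad f x) = (\<lambda>h. h \<bullet> D)"
    using has_derivative_unique[OF has_derivative_grad assms] assms differentiableI by blast
  then have "h \<bullet> grad f x = h \<bullet> D" for h by (rule fun_cong)
  then show ?thesis using vector_eq_ldot by blast
qed

lemma C1I: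
  assumes "\<And>x. (f has_derivative (\<lambda>h. h \<bullet> D x)) (at x)" "continuous_on UNIV D"
  shows "f \<in> C1"
proof -
  have "grad f = D" using grad_eqI[OF assms(1)] by auto
  then show ?thesis using assms differentiableI unfolding C1_def by blast
qed

lemma C1_has_derivative: "f \<in> C1 \<Longrightarrow> (f has_derivative (\<lambda>h. h \<bullet> grad f x)) (at x)"
  by (intro has_derivative_grad) (simp add: C1_def)

lemma C1_continuous: "f \<in> C1 \<Longrightarrow> continuous_on S f"
  by (meson C1_has_derivative has_derivative_continuous continuous_at_imp_continuous_on)

lemma C1_continuous_grad: "f \<in> C1 \<Longrightarrow> continuous_on UNIV (grad f)"
  by (simp add: C1_def)

lemma C1_mult:
  assumes "f \<in> C1" "g \<in> C1"
  shows "(\<lambda>x. f x * g x) \<in> C1" and "grad (\<lambda>x. f x * g x) x = f x *\<^sub>R grad g x + g x *\<^sub>R grad f x"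
proof -
  have D: "((\<lambda>x. f x * g x) has_derivative (\<lambda>h. h \<bullet> (f x *\<^sub>R grad g x + g x *\<^sub>R grad f x))) (at x)" for x
    by (rule has_derivative_eq_rhs[OF has_derivative_mult[OF C1_has_derivative[OF assms(1)] C1_has_derivative[OF assms(2)]]])
      (auto simp: inner_add_right)
  show "(\<lambda>x. f x * g x) \<in> C1"
    by (rule C1I[OF D]) (intro continuous_intros C1_continuous C1_continuous_grad assms)
  show "grad (\<lambda>x. f x * g x) x = f x *\<^sub>R grad g x + g x *\<^sub>R grad f x"
    by (rule grad_eqI[OF D])
qed

lemma C1_diff:
  assumes "f \<in> C1" "g \<in> C1"
  shows "(\<lambda>x. f x - g x) \<in> C1" and "grad (\<lambda>x. f x - g x) x = grad f x - grad g x"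
proof -
  have D: "((\<lambda>x. f x - g x) has_derivative (\<lambda>h. h \<bullet> (grad f x - grad g x))) (at x)" for x
    by (rule has_derivative_eq_rhs[OF has_derivative_diff[OF C1_has_derivative[OF assms(1)] C1_has_derivative[OF assms(2)]]])
      (auto simp: inner_diff_right)
  show "(\<lambda>x. f x - g x) \<in> C1"
    by (rule C1I[OF D]) (intro continuous_intros C1_continuous C1_continuous_grad assms)
  show "grad (\<lambda>x. f x - g x) x = grad f x - grad g x"
    by (rule grad_eqI[OF D])
qed

lemma frechet_derivative_grad: "f differentiable (at z) \<Longrightarrow> frechet_derivative f (at z) b = b \<bullet> grad f z"
  using frechet_derivative_at[OF has_derivative_grad, of f z] by metis

lemma C1I_partial:
  assumes "\<And>z. f differentiable (at z)"
    and "\<And>b. b \<in> Basis \<Longrightarrow> continuous_on UNIV (\<lambda>z. frechet_derivative f (at z) b)"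
  shows "f \<in> C1"
proof -
  have "grad f z = (\<Sum>b\<in>Basis. frechet_derivative f (at z) b *\<^sub>R b)" for z
    using euclidean_representation[of "grad f z"] assms(1)
    by (simp add: frechet_derivative_grad inner_commute[of _ "grad f z"])
  then have "grad f = (\<lambda>z. \<Sum>b\<in>Basis. frechet_derivative f (at z) b *\<^sub>R b)" by auto
  then show ?thesis
    unfolding C1_def using assms by (auto intro!: continuous_intros)
qed

lemma Cb2_C1:
  assumes "f \<in> Cb2"
  shows "f \<in> C1"
proof (rule C1I_partial)
  have *: "(length bs < 2 \<longrightarrow> (\<forall>z. pderivs bs f differentiable (at z))) \<and> continuous_on UNIV (pderivs bs f)"
    if "bs \<in> lists Basis" "length bs \<le> 2" for bs
    using assms that unfolding Cb2_def by blast
  show "f differentiable (at z)" for z using *[of "[]"] by simp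
  show "continuous_on UNIV (\<lambda>z. frechet_derivative f (at z) b)" if "b \<in> Basis" for b
    using *[of "[b]"] that by simp
qed

lemma Cb2_bounded:
  assumes "f \<in> Cb2"
  obtains C where "0 < C" "\<And>z. \<bar>f z\<bar> \<le> C"
proof -
  have "\<forall>bs\<in>lists Basis. length bs \<le> 2 \<longrightarrow> bounded (range (pderivs bs f))"
    using assms unfolding Cb2_def by blast
  from bspec[OF this, of "[]"] show ?thesis using that by (auto simp: bounded_pos)
qed

lemma schwartz_C1:
  assumes "f \<in> schwartz"
  shows "f \<in> C1"
proof (rule C1I_partial)
  have *: "(\<forall>z. pderivs bs f differentiable (at z))" if "bs \<in> lists Basis" for bs
    using assms that unfolding schwartz_def by blast
  show "f differentiable (at z)" for z using *[of "[]"] by simp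
  show "continuous_on UNIV (\<lambda>z. frechet_derivative f (at z) b)" if "b \<in> Basis" for b
    using *[of "[b]"] that
    by (auto intro!: continuous_at_imp_continuous_on differentiable_imp_continuous_within)
qed

lemma schwartz_decay:
  assumes "f \<in> schwartz"
  obtains C where "0 \<le> C" "\<And>z. \<bar>f z\<bar> * (1 + norm z) ^ k \<le> C"
proof -
  have "\<exists>C. 0 \<le> C \<and> (\<forall>z. \<bar>f z\<bar> * norm z ^ j \<le> C)" for j
  proof -
    have "bounded (range (\<lambda>z. norm z ^ j * pderivs [] f z))"
      using assms unfolding schwartz_def by blast
    then obtain C where "0 < C" "\<And>z. \<bar>f z\<bar> * norm z ^ j \<le> C"
      by (auto simp: bounded_pos abs_mult mult.commute)
    then show ?thesis by (intro exI[of _ C]) auto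
  qed
  then obtain C where C: "\<And>j. 0 \<le> C j" "\<And>j z. \<bar>f z\<bar> * norm z ^ j \<le> C j" by metis
  have "\<bar>f z\<bar> * (1 + norm z) ^ k \<le> (\<Sum>j\<le>k. real (k choose j) * C j)" for z
  proof -
    have "\<bar>f z\<bar> * (1 + norm z) ^ k = (\<Sum>j\<le>k. real (k choose j) * (\<bar>f z\<bar> * norm z ^ j))"
      unfolding add.commute[of 1 "norm z"] binomial_ring by (simp add: sum_distrib_left ac_simps)
    also have "\<dots> \<le> (\<Sum>j\<le>k. real (k choose j) * C j)"
      by (intro sum_mono mult_left_mono C) auto
    finally show ?thesis .
  qed
  then show ?thesis using that[of "\<Sum>j\<le>k. real (k choose j) * C j"] C by (simp add: sum_nonneg)
qed

text \<open>The Hamiltonian part differentiates along the vector field \<open>(v, - \<nabla>Vt x)\<close>; in particular it is a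
derivation.\<close>

lemma L_H_eq:
  fixes f :: "'a::euclidean_space \<times> 'a \<Rightarrow> real"
  assumes "f \<in> C1"
  shows "L_H Vt f z = (snd z, - grad Vt (fst z)) \<bullet> grad f z"
proof -
  obtain x v where z: "z = (x, v)" by (cases z)
  have D: "(f has_derivative (\<lambda>h. h \<bullet> grad f (x, v))) (at (x, v))"
    using assms by (rule C1_has_derivative)
  have 1: "grad (\<lambda>y. f (y, v)) x = fst (grad f (x, v))"
  proof (rule grad_eqI)
    have "((\<lambda>y. (y, v)) has_derivative (\<lambda>h. (h, 0))) (at x)"
      by (auto intro!: derivative_eq_intros)
    from has_derivative_compose[OF this D]
    show "((\<lambda>y. f (y, v)) has_derivative (\<lambda>h. h \<bullet> fst (grad f (x, v)))) (at x)"
      by (rule has_derivative_eq_rhs) (simp add: inner_prod_def)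
  qed
  have 2: "grad (\<lambda>w. f (x, w)) v = snd (grad f (x, v))"
  proof (rule grad_eqI)
    have "((\<lambda>w. (x, w)) has_derivative (\<lambda>h. (0, h))) (at v)"
      by (auto intro!: derivative_eq_intros)
    from has_derivative_compose[OF this D]
    show "((\<lambda>w. f (x, w)) has_derivative (\<lambda>h. h \<bullet> snd (grad f (x, v)))) (at v)"
      by (rule has_derivative_eq_rhs) (simp add: inner_prod_def)
  qed
  show ?thesis by (simp add: L_H_def z 1 2 inner_prod_def)
qed

lemma continuous_on_L_H:
  assumes "Vt \<in> C1" "f \<in> C1"
  shows "continuous_on UNIV (L_H Vt f)"
  unfolding L_H_eq[OF assms(2), abs_def]
  by (intro continuous_intros C1_continuous_grad assms
      continuous_on_compose2[OF C1_continuous_grad[OF assms(1)]]) auto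

lemma L_H_mult:
  assumes "f \<in> C1" "g \<in> C1"
  shows "L_H Vt (\<lambda>z. f z * g z) z = L_H Vt f z * g z + f z * L_H Vt g z"
  unfolding L_H_eq[OF assms(1)] L_H_eq[OF assms(2)] L_H_eq[OF C1_mult(1)[OF assms]] C1_mult(2)[OF assms]
  by (simp add: inner_add_right)

lemma compact_support_bounded:
  fixes f :: "'b::topological_space \<Rightarrow> real"
  assumes "continuous_on UNIV f" "compact K" "\<And>z. z \<notin> K \<Longrightarrow> f z = 0"
  obtains C where "0 < C" "\<And>z. \<bar>f z\<bar> \<le> C"
proof -
  have "compact (f ` K)" using assms by (intro compact_continuous_image) (auto intro: continuous_on_subset)
  then obtain C where "0 < C" "\<And>z. z \<in> K \<Longrightarrow> \<bar>f z\<bar> \<le> C"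
    by (metis compact_imp_bounded bounded_pos imageI real_norm_def)
  then have "\<bar>f z\<bar> \<le> C" for z using assms(3)[of z] by (cases "z \<in> K") auto
  with \<open>0 < C\<close> show ?thesis using that by blast
qed

lemma integral_lborel_translate:
  fixes f :: "'b::euclidean_space \<Rightarrow> real"
  assumes "integrable lborel f"
  shows "integrable lborel (\<lambda>z. f (z + c))" "(LINT z|lborel. f (z + c)) = (LINT z|lborel. f z)"
  using lborel_preserving_integral[OF lborel_distr_plus _ assms, of c] by (simp_all add: add.commute)

text \<open>The integral of \<open>F (z + t b)\<close> does not depend on \<open>t\<close>. Only differentiability along \<open>b\<close> is assumed,
because \<open>F\<close> will contain a factor \<open>\<nabla>Vt x\<close>, which is merely continuous in \<open>x\<close>.\<close>

lemma integral_directional_derivative_eq_0: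
  fixes F F' :: "'b::euclidean_space \<Rightarrow> real"
  assumes cont: "continuous_on UNIV F" "continuous_on UNIV F'"
    and K: "compact K" "\<And>z. z \<notin> K \<Longrightarrow> F z = 0"
    and der: "\<And>z. ((\<lambda>t. F (z + t *\<^sub>R b)) has_real_derivative F' z) (at 0)"
  shows "integrable lborel F'" "(LINT z|lborel. F' z) = 0"
proof -
  have F'0: "F' z = 0" if "z \<notin> K" for z
  proof -
    have "open ((\<lambda>t. z + t *\<^sub>R b) -` (- K))"
      using K(1) by (intro open_vimage continuous_intros) (auto simp: compact_imp_closed)
    then have "((\<lambda>t. 0) has_real_derivative F' z) (at 0)"
      using der[of z] that K(2) by (elim has_field_derivative_transform_within_open) auto
    then show ?thesis using DERIV_const[of 0 "at 0"] DERIV_unique by blast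
  qed
  obtain C where C: "0 < C" "\<And>z. \<bar>F' z\<bar> \<le> C"
    using compact_support_bounded[OF cont(2) K(1) F'0] by blast
  \<comment> \<open>A compact set that contains the supports of all translates with \<open>\<bar>t\<bar> < 1\<close>.\<close>
  define K' where "K' = {x + y |x y. x \<in> K \<and> y \<in> closed_segment (- b) b}"
  have K': "compact K'" unfolding K'_def by (intro compact_sums K) auto
  have inK': "z \<in> K'" if "z + t *\<^sub>R b \<in> K" "\<bar>t\<bar> < 1" for z t
  proof -
    have "- (t *\<^sub>R b) \<in> closed_segment (- b) b"
      unfolding closed_segment_def using that(2)
      by (auto intro!: exI[of _ "(1 - t) / 2"] simp: algebra_simps diff_divide_distrib simp flip: scaleR_add_left)
    then show ?thesis unfolding K'_def using that(1) by (intro CollectI exI[of _ "z + t *\<^sub>R b"] exI[of _ "- (t *\<^sub>R b)"]) auto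
  qed
  have intF: "integrable lborel F" by (rule integrable_compact_support[OF cont(1) K])
  define B where "B z = indicator K' z * C" for z
  have "integrable lborel (\<lambda>z. indicator K' z *\<^sub>R C)"
    by (rule borel_integrable_compact[OF K']) auto
  then have B: "integrable lborel B" by (simp add: B_def[abs_def])
  have d: "((\<lambda>s. F (z + s *\<^sub>R b)) has_real_derivative F' (z + t *\<^sub>R b)) (at t)" for z t
    using der[of "z + t *\<^sub>R b"] DERIV_shift[of "\<lambda>s. F (z + s *\<^sub>R b)" "F' (z + t *\<^sub>R b)" 0 t]
    by (simp add: algebra_simps)
  have bnd: "\<bar>F' (z + t *\<^sub>R b)\<bar> \<le> B z" if "\<bar>t\<bar> < 1" for z t
    using inK'[of z t] F'0[of "z + t *\<^sub>R b"] C that by (cases "z + t *\<^sub>R b \<in> K") (auto simp: B_def)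
  note * = has_real_derivative_integral[where F="\<lambda>t z. F (z + t *\<^sub>R b)" and F'="\<lambda>t z. F' (z + t *\<^sub>R b)" and d=1 and M=lborel and B=B,
      OF _ integral_lborel_translate(1)[OF intF] d bnd B]
  show "integrable lborel F'" using *(1) by simp
  have "((\<lambda>t. LINT z|lborel. F z) has_real_derivative (LINT z|lborel. F' z)) (at (0::real))"
    using *(2) by (simp add: integral_lborel_translate(2)[OF intF])
  then show "(LINT z|lborel. F' z) = 0" using DERIV_const DERIV_unique by blast
qed

text \<open>The vector field is divergence free: its \<open>x\<close> component depends on \<open>v\<close> alone and its \<open>v\<close> component
on \<open>x\<close> alone, so each coordinate of it may be moved under the derivative that it multiplies.\<close>

lemma integral_L_H_eq_0:
  fixes H :: "'a::euclidean_space \<times> 'a \<Rightarrow> real"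
  assumes Vt: "Vt \<in> C1" and H: "H \<in> C1" and K: "compact K" "\<And>z. z \<notin> K \<Longrightarrow> H z = 0"
  shows "(LINT z|lborel. L_H Vt H z) = 0"
proof -
  define P where "P b z = (snd z \<bullet> b) * ((b, 0) \<bullet> grad H z)" for b :: 'a and z
  define Q where "Q b z = (grad Vt (fst z) \<bullet> b) * ((0, b) \<bullet> grad H z)" for b :: 'a and z
  have dH: "((\<lambda>t. H (z + t *\<^sub>R c)) has_real_derivative (c \<bullet> grad H z)) (at 0)" for z c
  proof -
    have "((\<lambda>t. z + t *\<^sub>R c) has_derivative (\<lambda>t. t *\<^sub>R c)) (at (0::real))"
      by (auto intro!: derivative_eq_intros)
    moreover have "(H has_derivative (\<lambda>h. h \<bullet> grad H z)) (at (z + 0 *\<^sub>R c))"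
      using C1_has_derivative[OF H] by simp
    ultimately have "((\<lambda>t. H (z + t *\<^sub>R c)) has_derivative (\<lambda>t. (t *\<^sub>R c) \<bullet> grad H z)) (at 0)"
      by (rule has_derivative_compose)
    then show ?thesis by (simp add: has_field_derivative_def mult_commute_abs)
  qed
  have cH: "continuous_on UNIV H" and cgH: "continuous_on UNIV (grad H)"
    using H by (auto intro: C1_continuous C1_continuous_grad)
  have contg: "continuous_on UNIV (\<lambda>z. grad Vt (fst z))"
    by (rule continuous_on_compose2[OF C1_continuous_grad[OF Vt]]) (auto intro!: continuous_intros)
  have P: "integrable lborel (P b)" "(LINT z|lborel. P b z) = 0" for b
  proof -
    have "((\<lambda>t. (snd (z + t *\<^sub>R (b, 0)) \<bullet> b) * H (z + t *\<^sub>R (b, 0))) has_real_derivative P b z) (at 0)" for z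
      unfolding P_def using DERIV_cmult[OF dH[of z "(b, 0)"], of "snd z \<bullet> b"] by simp
    note * = integral_directional_derivative_eq_0[where F="\<lambda>z. (snd z \<bullet> b) * H z" and F'="P b", OF _ _ K(1) _ this]
    show "integrable lborel (P b)" "(LINT z|lborel. P b z) = 0"
      by (rule *; auto simp: K(2) P_def[abs_def] intro!: continuous_intros cH cgH contg)+
  qed
  have Q: "integrable lborel (Q b)" "(LINT z|lborel. Q b z) = 0" for b
  proof -
    have "((\<lambda>t. (grad Vt (fst (z + t *\<^sub>R (0, b))) \<bullet> b) * H (z + t *\<^sub>R (0, b))) has_real_derivative Q b z) (at 0)" for z
      unfolding Q_def using DERIV_cmult[OF dH[of z "(0, b)"], of "grad Vt (fst z) \<bullet> b"] by simp
    note * = integral_directional_derivative_eq_0[where F="\<lambda>z. (grad Vt (fst z) \<bullet> b) * H z" and F'="Q b", OF _ _ K(1) _ this]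
    show "integrable lborel (Q b)" "(LINT z|lborel. Q b z) = 0"
      by (rule *; auto simp: K(2) Q_def[abs_def] intro!: continuous_intros cH cgH contg)+
  qed
  have "L_H Vt H z = (\<Sum>b\<in>Basis. P b z - Q b z)" for z
    unfolding L_H_eq[OF H] P_def Q_def sum_subtractf
    by (simp add: inner_prod_def euclidean_inner[of "snd z"] euclidean_inner[of "grad Vt (fst z)"] inner_commute)
  then show ?thesis using P Q by simp
qed

lemma L_H_integration_by_parts:
  fixes f g :: "'a::euclidean_space \<times> 'a \<Rightarrow> real"
  assumes Vt: "Vt \<in> C1" and f: "f \<in> C1" and g: "g \<in> C1" and K: "compact K" "\<And>z. z \<notin> K \<Longrightarrow> f z = 0"
  shows "integrable lborel (\<lambda>z. L_H Vt f z * g z)" "integrable lborel (\<lambda>z. f z * L_H Vt g z)"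
    "(LINT z|lborel. L_H Vt f z * g z) = - (LINT z|lborel. f z * L_H Vt g z)"
proof -
  have f0: "L_H Vt f z = 0" if "z \<notin> K" for z
  proof -
    have "(f has_derivative (\<lambda>h. h \<bullet> 0)) (at z)"
      by (rule has_derivative_transform_within_open[of "\<lambda>_. 0" _ _ _ "- K"])
        (use K that compact_imp_closed in auto)
    from grad_eqI[OF this] show ?thesis by (simp add: L_H_eq[OF f])
  qed
  show 1: "integrable lborel (\<lambda>z. L_H Vt f z * g z)"
    by (rule integrable_compact_support[OF _ K(1)])
      (simp_all add: f0 continuous_on_mult[OF continuous_on_L_H[OF Vt f] C1_continuous[OF g]])
  show 2: "integrable lborel (\<lambda>z. f z * L_H Vt g z)"
    by (rule integrable_compact_support[OF _ K(1)])
      (simp_all add: K(2) continuous_on_mult[OF C1_continuous[OF f] continuous_on_L_H[OF Vt g]])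
  have "(LINT z|lborel. L_H Vt (\<lambda>z. f z * g z) z) = 0"
    by (rule integral_L_H_eq_0[OF Vt C1_mult(1)[OF f g] K(1)]) (simp add: K(2))
  then show "(LINT z|lborel. L_H Vt f z * g z) = - (LINT z|lborel. f z * L_H Vt g z)"
    using 1 2 by (simp add: L_H_mult[OF f g])
qed

section \<open>Uniqueness of formal adjoints\<close>

lemma DERIV_max_0_power:
  "((\<lambda>t::real. max 0 t ^ Suc (Suc n)) has_real_derivative real (Suc (Suc n)) * max 0 t ^ Suc n) (at t)"
proof -
  consider "t > 0" | "t < 0" | "t = 0" by linarith
  then show ?thesis
  proof cases
    case 1
    have "((\<lambda>t. t ^ Suc (Suc n)) has_real_derivative real (Suc (Suc n)) * max 0 t ^ Suc n) (at t)"
      using DERIV_pow[of "Suc (Suc n)" t] 1 by (simp del: power_Suc of_nat_Suc)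
    then show ?thesis
      by (rule has_field_derivative_transform_within_open[where S="{0<..}"]) (use 1 in auto)
  next
    case 2
    have "((\<lambda>t. 0) has_real_derivative real (Suc (Suc n)) * max 0 t ^ Suc n) (at t)"
      using 2 by (auto intro!: derivative_eq_intros)
    then show ?thesis
      by (rule has_field_derivative_transform_within_open[where S="{..<0}"]) (use 2 in auto)
  next
    case 3
    have "((\<lambda>h::real. max 0 h ^ Suc n) \<longlongrightarrow> max 0 0 ^ Suc n) (at 0)"
      by (intro tendsto_intros)
    moreover have "\<forall>\<^sub>F h::real in at 0. max 0 h ^ Suc n = (max 0 (0 + h) ^ Suc (Suc n) - max 0 0 ^ Suc (Suc n)) / h"
      by (auto simp: eventually_at_filter max_def)
    ultimately show ?thesis
      unfolding 3 DERIV_def by (auto elim: Lim_transform_eventually)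
  qed
qed

text \<open>The third power is the smallest that makes the truncated paraboloid twice continuously
differentiable.\<close>

definition bump :: "'b::euclidean_space \<Rightarrow> real \<Rightarrow> 'b \<Rightarrow> real" where
  "bump c r z = max 0 (r\<^sup>2 - (norm (z - c))\<^sup>2) ^ 3"

lemma bump_Cc2:
  assumes "0 < r"
  shows "bump c r \<in> Cc2"
proof -
  define m where "m z = r\<^sup>2 - (norm (z - c))\<^sup>2" for z
  have m0: "max 0 (m z) = 0" if "z \<notin> cball c r" for z
  proof -
    have "r < norm (z - c)" using that by (simp add: dist_norm norm_minus_commute)
    then have "r\<^sup>2 < (norm (z - c))\<^sup>2" using assms by (intro power_strict_mono) auto
    then show ?thesis by (simp add: m_def)
  qed
  have mc: "continuous_on UNIV m" unfolding m_def by (intro continuous_intros)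
  have dm: "(m has_derivative (\<lambda>h. - 2 * ((z - c) \<bullet> h))) (at z)" for z
    unfolding m_def power2_norm_eq_inner
    by (auto intro!: derivative_eq_intros simp: inner_commute)
  have dp: "((\<lambda>z. max 0 (m z) ^ Suc (Suc n)) has_derivative
      (\<lambda>h. real (Suc (Suc n)) * max 0 (m z) ^ Suc n * (- 2 * ((z - c) \<bullet> h)))) (at z)" for n z
    using has_derivative_compose[OF dm DERIV_max_0_power[unfolded has_field_derivative_def]] by blast
  define B where "B = bump c r"
  have B: "B = (\<lambda>z. max 0 (m z) ^ 3)" by (auto simp: B_def bump_def m_def)
  have d0: "(B has_derivative (\<lambda>h. - 6 * max 0 (m z) ^ 2 * ((z - c) \<bullet> h))) (at z)" for z
    using dp[of 1 z] by (simp add: B numeral_3_eq_3 numeral_2_eq_2 mult_ac)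
  define P where "P b z = - 6 * max 0 (m z) ^ 2 * ((z - c) \<bullet> b)" for b z
  have P: "pderivs [b] B = P b" for b
    using frechet_derivative_at[OF d0] by (auto simp: P_def fun_eq_iff)
  define Q where "Q a b z = 24 * max 0 (m z) * ((z - c) \<bullet> a) * ((z - c) \<bullet> b) - 6 * max 0 (m z) ^ 2 * (a \<bullet> b)" for a b z
  have d1: "(P b has_derivative (\<lambda>a. Q a b z)) (at z)" for b z
  proof -
    have "((\<lambda>z. max 0 (m z) ^ 2) has_derivative (\<lambda>h. 2 * max 0 (m z) * (- 2 * ((z - c) \<bullet> h)))) (at z)"
      using dp[of 0 z] by (simp add: numeral_2_eq_2)
    then have "((\<lambda>z. max 0 (m z) ^ 2 * (- 6 * ((z - c) \<bullet> b))) has_derivative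
        (\<lambda>h. max 0 (m z) ^ 2 * (- 6 * (h \<bullet> b)) + 2 * max 0 (m z) * (- 2 * ((z - c) \<bullet> h)) * (- 6 * ((z - c) \<bullet> b)))) (at z)"
      by (rule has_derivative_mult) (auto intro!: derivative_eq_intros)
    moreover have "P b = (\<lambda>z. max 0 (m z) ^ 2 * (- 6 * ((z - c) \<bullet> b)))" by (simp add: P_def fun_eq_iff)
    ultimately show ?thesis by (simp add: Q_def algebra_simps)
  qed
  have Q: "pderivs [a, b] B = Q a b" for a b
  proof -
    have "pderivs [a, b] B = (\<lambda>z. frechet_derivative (P b) (at z) a)"
      by (subst pderivs.simps(2)) (simp only: P)
    then show ?thesis by (simp add: frechet_derivative_at[OF d1, symmetric])
  qed
  have cB: "continuous_on UNIV B" "continuous_on UNIV (P b)" "continuous_on UNIV (Q a b)" for a b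
    unfolding B P_def Q_def by (intro continuous_intros mc)+
  have z: "B z = 0" "P b z = 0" "Q a b z = 0" if "z \<notin> cball c r" for z a b
    using m0[OF that] by (simp_all add: B P_def Q_def)
  have bd: "bounded (range f)" if f: "continuous_on UNIV f" and f0: "\<And>z. z \<notin> cball c r \<Longrightarrow> f z = 0" for f :: "'a \<Rightarrow> real"
  proof -
    obtain C where "0 < C" "\<And>z. \<bar>f z\<bar> \<le> C"
      using compact_support_bounded[OF f compact_cball f0] by blast
    then show ?thesis by (auto simp: bounded_iff)
  qed
  have "B \<in> Cb2"
    unfolding Cb2_def
  proof (intro CollectI ballI impI)
    fix bs :: "'a list" assume "bs \<in> lists Basis" and len: "length bs \<le> 2"
    consider "bs = []" | b where "bs = [b]" | a b where "bs = [a, b]"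
      using len by (cases bs; cases "tl bs") auto
    then show "(length bs < 2 \<longrightarrow> (\<forall>z. pderivs bs B differentiable at z)) \<and>
         continuous_on UNIV (pderivs bs B) \<and> bounded (range (pderivs bs B))"
    proof cases
      case 1
      then show ?thesis using cB z bd[of B] differentiableI[OF d0] by auto
    next
      case (2 b)
      then show ?thesis unfolding 2 P using cB z bd[of "P b"] differentiableI[OF d1] by auto
    next
      case (3 a b)
      then show ?thesis unfolding 3 Q using cB z bd[of "Q a b"] by auto
    qed
  qed
  moreover have "compact (closure {z. B z \<noteq> 0})"
  proof -
    have "{z. B z \<noteq> 0} \<subseteq> cball c r" using z(1) by blast
    then show ?thesis using bounded_subset[OF bounded_cball] by (simp add: compact_closure)
  qed
  ultimately show ?thesis by (simp add: Cc2_def B_def)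
qed

text \<open>If two continuous candidates differ at a point, their difference keeps its sign on a ball around it,
and a bump function supported there separates them.\<close>

lemma formal_adjoint_unique:
  fixes w :: "'b::euclidean_space \<Rightarrow> real"
  assumes w: "continuous_on UNIV w" "\<And>z. 0 < w z"
    and h1: "is_formal_adjoint w T g h1" and h2: "is_formal_adjoint w T g h2"
  shows "h1 = h2"
proof -
  have le: "h2 c \<le> h1 c" if h1: "is_formal_adjoint w T g h1" and h2: "is_formal_adjoint w T g h2" for h1 h2 c
  proof (rule ccontr)
    assume "\<not> h2 c \<le> h1 c"
    define d where "d z = (h2 z - h1 z) * w z" for z
    have cd: "continuous_on UNIV d"
      unfolding d_def using h1 h2 w(1) by (auto simp: is_formal_adjoint_def intro!: continuous_intros)
    have "0 < d c" using \<open>\<not> h2 c \<le> h1 c\<close> w(2) by (simp add: d_def)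
    moreover have "open (d -` {0<..})" using cd by (intro open_vimage) auto
    ultimately obtain r where r: "0 < r" "cball c r \<subseteq> d -` {0<..}" 
      by (metis open_contains_cball vimageI greaterThan_iff)
    define B where "B = bump c r"
    have B: "B \<in> Cc2" unfolding B_def by (rule bump_Cc2[OF r(1)])
    have B0: "0 \<le> B z" for z by (simp add: B_def bump_def)
    have Bpos: "0 < B z \<longleftrightarrow> z \<in> ball c r" for z
    proof -
      have "0 < B z \<longleftrightarrow> (norm (z - c))\<^sup>2 < r\<^sup>2"
        unfolding B_def bump_def by (auto simp: zero_less_power_eq max_def)
      also have "\<dots> \<longleftrightarrow> norm (z - c) < r" using r(1) by (metis abs_of_pos norm_ge_zero power2_less_imp_less power_strict_mono less_imp_le zero_less_numeral)
      finally show ?thesis by (simp add: dist_norm norm_minus_commute)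
    qed
    have Bd: "0 \<le> B z * d z" for z
      using Bpos[of z] B0[of z] r(2) by (cases "z \<in> ball c r") (auto simp: subset_iff order.order_iff_strict)
    have i1: "integrable lborel (\<lambda>z. B z * h1 z * w z)" and i2: "integrable lborel (\<lambda>z. B z * h2 z * w z)"
      and eq: "(LINT z|lborel. B z * h1 z * w z) = (LINT z|lborel. B z * h2 z * w z)"
      using h1 h2 B by (auto simp: is_formal_adjoint_def)
    have Bdeq: "B z * d z = B z * h2 z * w z - B z * h1 z * w z" for z by (simp add: d_def algebra_simps)
    have "integrable lborel (\<lambda>z. B z * d z)" "(LINT z|lborel. B z * d z) = 0"
      unfolding Bdeq using i1 i2 eq by simp_all
    then have "AE z in lborel. B z * d z = 0"
      using integral_nonneg_eq_0_iff_AE[of lborel "\<lambda>z. B z * d z"] Bd by simp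
    moreover have "z \<notin> ball c r" if "B z * d z = 0" for z
    proof
      assume "z \<in> ball c r"
      then have "0 < B z" "0 < d z" using Bpos r(2) by (auto simp: subset_iff)
      then show False using that by simp
    qed
    ultimately have "AE z in lborel. z \<notin> ball c r" by (auto elim: AE_mp)
    then have "ball c r \<in> null_sets lborel"
      using AE_iff_null_sets[of "ball c r" lborel] by (simp add: borel_open)
    then have "negligible (ball c r)" by (simp add: negligible_iff_null_sets null_sets_completionI)
    then show False using open_not_negligible[of "ball c r"] r(1) by simp
  qed
  show ?thesis using le[OF h1 h2] le[OF h2 h1] by (intro ext antisym)
qed

lemma formal_adjoint_eqI:
  fixes w :: "'b::euclidean_space \<Rightarrow> real"
  assumes "continuous_on UNIV w" "\<And>z. 0 < w z" and "is_formal_adjoint w T g h"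
  shows "formal_adjoint w T g = h"
  unfolding formal_adjoint_def by (rule the_equality[where P="is_formal_adjoint w T g", OF assms(3)]) (rule formal_adjoint_unique[OF assms(1,2) _ assms(3)])

section \<open>Adjoints of the generator\<close>

lemma norm_bounce [simp]: "norm (bounce U z) = norm z"
  by (simp add: bounce_def norm_prod_def)

lemma fst_bounce [simp]: "fst (bounce U z) = fst z"
  and snd_bounce: "snd (bounce U z) = reflect U (fst z) (snd z)"
  by (simp_all add: bounce_def)

lemma rate_bounce:
  "rate U (fst z) (reflect U (fst z) (snd z)) = - rate U (fst z) (snd z)"
  "rate_pos U (fst z) (reflect U (fst z) (snd z)) = rate_neg U (fst z) (snd z)"
  by (simp_all add: rate_pos_def rate_neg_def rate_reflect)

lemma continuous_on_rate:
  assumes "U \<in> C1"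
  shows "continuous_on UNIV (\<lambda>z. rate U (fst z) (snd z))"
    "continuous_on UNIV (\<lambda>z. rate_pos U (fst z) (snd z))"
    "continuous_on UNIV (\<lambda>z. rate_neg U (fst z) (snd z))"
proof -
  have "continuous_on UNIV (\<lambda>z::'a\<times>'a. grad U (fst z))"
    by (rule continuous_on_compose2[OF C1_continuous_grad[OF assms]]) (auto intro!: continuous_intros)
  then show *: "continuous_on UNIV (\<lambda>z. rate U (fst z) (snd z))"
    unfolding rate_def by (intro continuous_intros)
  show "continuous_on UNIV (\<lambda>z. rate_pos U (fst z) (snd z))"
    "continuous_on UNIV (\<lambda>z. rate_neg U (fst z) (snd z))"
    unfolding rate_pos_def rate_neg_def by (intro continuous_intros *)+
qed

text \<open>The reflection is discontinuous where the gradient vanishes, but there the rate vanishes as well and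
\<open>f\<close> is bounded.\<close>

lemma continuous_on_rate_bounce:
  fixes f r :: "'a::euclidean_space \<times> 'a \<Rightarrow> real"
  assumes U: "U \<in> C1" and r: "continuous_on UNIV r" "\<And>z. \<bar>r z\<bar> \<le> \<bar>rate U (fst z) (snd z)\<bar>"
    and f: "continuous_on UNIV f" "\<And>z. \<bar>f z\<bar> \<le> C"
  shows "continuous_on UNIV (\<lambda>z. r z * f (bounce U z))"
proof (rule continuous_at_imp_continuous_on, rule ballI)
  fix z0 :: "'a \<times> 'a"
  have rc: "isCont r z0" and fc: "\<And>z. isCont f z"
    using r(1) f(1) unfolding continuous_on_eq_continuous_at[OF open_UNIV] by blast+
  show "isCont (\<lambda>z. r z * f (bounce U z)) z0"
  proof (cases "grad U (fst z0) = 0")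
    case True
    then have r0: "r z0 = 0" using r(2)[of z0] by (simp add: rate_def)
    have "(r \<longlongrightarrow> 0) (at z0)" using rc r0 by (simp add: isCont_def)
    then have "((\<lambda>z. r z * f (bounce U z)) \<longlongrightarrow> 0) (at z0)"
      by (rule tendsto_0_le[where K=C]) (auto simp: abs_mult intro!: always_eventually mult_left_mono f(2))
    then show ?thesis by (simp add: isCont_def r0)
  next
    case False
    have "isCont (grad U) (fst z0)"
      using C1_continuous_grad[OF U] by (auto simp: continuous_on_eq_continuous_at)
    then have g: "isCont (\<lambda>z. grad U (fst z)) z0"
      by (rule isCont_o2[OF isCont_fst[OF continuous_ident]])
    have "isCont (bounce U) z0"
      unfolding bounce_def[abs_def] reflect_def using False
      by (intro continuous_intros g) auto
    then show ?thesis
      by (intro continuous_intros rc isCont_o2[where g=f and f="bounce U"] fc)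
  qed
qed

lemma bounce_dual:
  fixes f r G :: "'a::euclidean_space \<times> 'a \<Rightarrow> real"
  assumes U: "U \<in> C1" and r: "continuous_on UNIV r" "\<And>z. \<bar>r z\<bar> \<le> \<bar>rate U (fst z) (snd z)\<bar>"
    and f: "continuous_on UNIV f" "\<And>z. z \<notin> cball 0 R \<Longrightarrow> f z = 0"
    and G: "continuous_on UNIV G"
  shows "integrable lborel (\<lambda>z. r z * f (bounce U z) * G z)"
    and "integrable lborel (\<lambda>z. f z * (r (bounce U z) * G (bounce U z)))"
    and "(LINT z|lborel. r z * f (bounce U z) * G z) = (LINT z|lborel. f z * (r (bounce U z) * G (bounce U z)))"
proof -
  obtain C where C: "\<And>z. \<bar>f z\<bar> \<le> C"
    using compact_support_bounded[OF f(1) compact_cball f(2)] by blast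
  show 1: "integrable lborel (\<lambda>z. r z * f (bounce U z) * G z)"
    by (rule integrable_compact_support[OF _ compact_cball[of 0 R]])
      (auto intro!: continuous_on_mult continuous_on_rate_bounce[OF U r f(1) C] G simp: f(2))
  show "integrable lborel (\<lambda>z. f z * (r (bounce U z) * G (bounce U z)))"
    "(LINT z|lborel. r z * f (bounce U z) * G z) = (LINT z|lborel. f z * (r (bounce U z) * G (bounce U z)))"
    using bounce_integral[OF U 1] by (simp_all add: mult_ac)
qed

lemma Cc2_support:
  assumes "f \<in> Cc2"
  obtains R where "\<And>z. z \<notin> cball 0 R \<Longrightarrow> f z = 0"
proof -
  have "bounded {z. f z \<noteq> 0}"
    using assms by (auto simp: Cc2_def intro: bounded_subset[OF compact_imp_bounded closure_subset])
  then obtain R where "\<forall>z\<in>{z. f z \<noteq> 0}. norm z \<le> R" by (auto simp: bounded_iff)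
  then show ?thesis using that[of R] by force
qed

lemma Cc2_Cb2: "f \<in> Cc2 \<Longrightarrow> f \<in> Cb2"
  by (simp add: Cc2_def)

lemma L_R_eq: "L_R U f z = rate_pos U (fst z) (snd z) * (f (bounce U z) - f z)"
  by (simp add: L_R_def bounce_def case_prod_beta)

lemma L_Q_eq: "L_Q lr f z = lr * ((LINT w|lborel. f (fst z, w) * gauss w) - f z)"
  by (simp add: L_Q_def case_prod_beta)

lemma L_Q_dual:
  fixes f G :: "'a::euclidean_space \<times> 'a \<Rightarrow> real"
  assumes G: "integrable lborel G" and f: "continuous_on UNIV f" "\<And>z. \<bar>f z\<bar> \<le> C"
  shows "integrable lborel (\<lambda>z. L_Q lr f z * G z)"
    and "integrable lborel (\<lambda>z. f z * (lr * (gauss (snd z) * (LINT w|lborel. G (fst z, w)) - G z)))"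
    and "(LINT z|lborel. L_Q lr f z * G z)
      = (LINT z|lborel. f z * (lr * (gauss (snd z) * (LINT w|lborel. G (fst z, w)) - G z)))"
proof -
  have [measurable]: "f \<in> borel_measurable borel" by (rule borel_measurable_continuous_onI[OF f(1)])
  have [measurable]: "G \<in> borel_measurable borel" using borel_measurable_integrable[OF G] by simp
  have bm: "(\<lambda>y::'a \<times> 'a \<times> 'a. f (fst y, snd (snd y))) \<in> borel_measurable borel"
    by (intro borel_measurable_continuous_onI continuous_on_compose2[OF f(1)] continuous_intros) auto
  note T = triple_integral[OF G bm f(2)]
  have fG: "integrable lborel (\<lambda>z. f z * G z)"
    using integrable_mult_bounded[OF G _ f(2)] by (simp add: mult.commute)
  have l: "L_Q lr f z * G z = lr * (G z * (LINT w|lborel. gauss w * f (fst z, w))) - lr * (f z * G z)" for z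
    by (simp add: L_Q_eq algebra_simps)
  have r: "f z * (lr * (gauss (snd z) * (LINT w|lborel. G (fst z, w)) - G z))
    = lr * (gauss (snd z) * (LINT w|lborel. G (fst z, w) * f z)) - lr * (f z * G z)" for z
    by (simp add: algebra_simps)
  show "integrable lborel (\<lambda>z. L_Q lr f z * G z)"
    unfolding l using T(3) fG by simp
  show "integrable lborel (\<lambda>z. f z * (lr * (gauss (snd z) * (LINT w|lborel. G (fst z, w)) - G z)))"
    unfolding r using T(5) fG by simp
  show "(LINT z|lborel. L_Q lr f z * G z)
      = (LINT z|lborel. f z * (lr * (gauss (snd z) * (LINT w|lborel. G (fst z, w)) - G z)))"
    unfolding l r using T(2-5) fG by simp
qed

text \<open>The explicit form of the Lebesgue adjoint of the generator, that is, the right hand side of the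
Fokker-Planck equation.\<close>

definition fokker_planck :: "('a::euclidean_space \<Rightarrow> real) \<Rightarrow> ('a \<Rightarrow> real) \<Rightarrow> real \<Rightarrow>
    ('a \<times> 'a \<Rightarrow> real) \<Rightarrow> 'a \<times> 'a \<Rightarrow> real" where
  "fokker_planck U Vt lr G z = - L_H Vt G z
     + lr * (gauss (snd z) * (LINT w|lborel. G (fst z, w)) - G z)
     + (rate_neg U (fst z) (snd z) * G (bounce U z) - rate_pos U (fst z) (snd z) * G z)"

text \<open>The explicit form of the Lebesgue adjoint of the antisymmetric part of the generator.\<close>

definition conservative_flow :: "('a::euclidean_space \<Rightarrow> real) \<Rightarrow> ('a \<Rightarrow> real) \<Rightarrow>
    ('a \<times> 'a \<Rightarrow> real) \<Rightarrow> 'a \<times> 'a \<Rightarrow> real" where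
  "conservative_flow U Vt G z = - L_H Vt G z - rate U (fst z) (snd z) / 2 * (G (bounce U z) + G z)"

text \<open>One computation for both adjoints: a weight \<open>w\<close> enters only through \<open>G = g w\<close>.\<close>

lemma gen_dual:
  fixes f G :: "'a::euclidean_space \<times> 'a \<Rightarrow> real" and V Vt :: "'a \<Rightarrow> real"
  assumes V: "V \<in> C1" and Vt: "Vt \<in> C1" and f: "f \<in> Cc2" and G: "G \<in> C1" "integrable lborel G"
  defines "U \<equiv> \<lambda>x. V x - Vt x"
  shows "integrable lborel (\<lambda>z. gen V Vt lr f z * G z)"
    and "integrable lborel (\<lambda>z. f z * fokker_planck U Vt lr G z)"
    and "(LINT z|lborel. gen V Vt lr f z * G z) = (LINT z|lborel. f z * fokker_planck U Vt lr G z)"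
proof -
  have U: "U \<in> C1" unfolding U_def by (rule C1_diff(1)[OF V Vt])
  obtain R where R: "\<And>z. z \<notin> cball 0 R \<Longrightarrow> f z = 0" using Cc2_support[OF f] by blast
  obtain C where C: "\<And>z. \<bar>f z\<bar> \<le> C" using Cb2_bounded[OF Cc2_Cb2[OF f]] by blast
  have f1: "f \<in> C1" by (rule Cb2_C1[OF Cc2_Cb2[OF f]])
  have fc: "continuous_on UNIV f" and Gc: "continuous_on UNIV G" using f1 G(1) by (auto intro: C1_continuous)
  note H = L_H_integration_by_parts[OF Vt f1 G(1) compact_cball[of 0 R] R]
  note Q = L_Q_dual[OF G(2) fc C, of lr]
  have rb: "\<bar>rate_pos U (fst z) (snd z)\<bar> \<le> \<bar>rate U (fst z) (snd z)\<bar>" for z by (simp add: rate_pos_def)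
  note B = bounce_dual[where R=R, OF U continuous_on_rate(2)[OF U] rb fc R Gc, unfolded fst_bounce snd_bounce rate_bounce]
  have fG: "integrable lborel (\<lambda>z. f z * (rate_pos U (fst z) (snd z) * G z))"
    by (rule integrable_compact_support[OF _ compact_cball[of 0 R]])
      (auto intro!: continuous_on_mult fc Gc continuous_on_rate[OF U] simp: R)
  have l: "gen V Vt lr f z * G z = L_H Vt f z * G z + L_Q lr f z * G z
      + (rate_pos U (fst z) (snd z) * f (bounce U z) * G z - f z * (rate_pos U (fst z) (snd z) * G z))" for z
    by (simp add: gen_def L_R_eq U_def[symmetric] algebra_simps)
  have r: "f z * fokker_planck U Vt lr G z = - (f z * L_H Vt G z)
      + f z * (lr * (gauss (snd z) * (LINT w|lborel. G (fst z, w)) - G z))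
      + (f z * (rate_neg U (fst z) (snd z) * G (bounce U z)) - f z * (rate_pos U (fst z) (snd z) * G z))" for z
    by (simp add: fokker_planck_def algebra_simps)
  show "integrable lborel (\<lambda>z. gen V Vt lr f z * G z)"
    unfolding l by (intro Bochner_Integration.integrable_add Bochner_Integration.integrable_diff H Q B fG)
  show "integrable lborel (\<lambda>z. f z * fokker_planck U Vt lr G z)"
    unfolding r by (intro Bochner_Integration.integrable_add Bochner_Integration.integrable_diff Bochner_Integration.integrable_minus H Q B fG)
  show "(LINT z|lborel. gen V Vt lr f z * G z) = (LINT z|lborel. f z * fokker_planck U Vt lr G z)"
    unfolding l r using H Q B fG
    by (simp add: Bochner_Integration.integral_add Bochner_Integration.integral_diff)
qed

lemma mu_eq: "mu V z = exp (- V (fst z)) * exp (- (norm (snd z))\<^sup>2 / 2)"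
  by (simp add: mu_def case_prod_beta)

lemma mu_pos: "0 < mu V z"
  by (simp add: mu_eq)

lemma mu_C1:
  assumes "V \<in> C1"
  shows "mu V \<in> C1" and "grad (mu V) z = mu V z *\<^sub>R (- grad V (fst z), - snd z)"
proof -
  have D: "(mu V has_derivative (\<lambda>h. h \<bullet> (mu V z *\<^sub>R (- grad V (fst z), - snd z)))) (at z)" for z
  proof -
    have "((\<lambda>z::'a \<times> 'a. V (fst z)) has_derivative (\<lambda>h. fst h \<bullet> grad V (fst z))) (at z)"
      by (rule has_derivative_compose[OF has_derivative_fst[OF has_derivative_ident] C1_has_derivative[OF assms]])
    then show ?thesis
      unfolding mu_eq[abs_def] power2_norm_eq_inner
      by (auto intro!: derivative_eq_intros simp: inner_prod_def algebra_simps inner_commute)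
  qed
  have c: "continuous_on UNIV (mu V)"
    by (meson D has_derivative_continuous continuous_at_imp_continuous_on)
  show "mu V \<in> C1"
    by (rule C1I[OF D]) (intro continuous_intros c continuous_on_compose2[OF C1_continuous_grad[OF assms]], auto)
  show "grad (mu V) z = mu V z *\<^sub>R (- grad V (fst z), - snd z)"
    by (rule grad_eqI[OF D])
qed

lemma L_H_mu:
  assumes "V \<in> C1" "Vt \<in> C1"
  shows "L_H Vt (mu V) z = - (rate (\<lambda>x. V x - Vt x) (fst z) (snd z) * mu V z)"
  unfolding L_H_eq[OF mu_C1(1)[OF assms(1)]] mu_C1(2)[OF assms(1)] rate_def C1_diff(2)[OF assms]
  by (simp add: inner_prod_def inner_diff_right inner_commute algebra_simps)

text \<open>The explicit form of the adjoint with respect to \<open>\<mu>\<close>, the generator of the time reversed process: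
the flow runs backwards, and reflections happen at the rate \<open>a\<^sub>-\<close>.\<close>

definition reversed_gen :: "('a::euclidean_space \<Rightarrow> real) \<Rightarrow> ('a \<Rightarrow> real) \<Rightarrow> real \<Rightarrow>
    ('a \<times> 'a \<Rightarrow> real) \<Rightarrow> 'a \<times> 'a \<Rightarrow> real" where
  "reversed_gen U Vt lr g z = - L_H Vt g z + L_Q lr g z + rate_neg U (fst z) (snd z) * (g (bounce U z) - g z)"

text \<open>The weight \<open>\<mu>\<close> is not invariant under the flow, which contributes \<open>+ a g \<mu>\<close>; together with the loss
term \<open>- a\<^sub>+ g \<mu>\<close> of the reflections this is \<open>- a\<^sub>- g \<mu>\<close>. In the refreshment term the
two Gaussian factors change places.\<close>

lemma fokker_planck_mu:
  assumes V: "V \<in> C1" and Vt: "Vt \<in> C1" and g: "g \<in> C1"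
  defines "U \<equiv> \<lambda>x. V x - Vt x"
  shows "fokker_planck U Vt lr (\<lambda>z. g z * mu V z) z = reversed_gen U Vt lr g z * mu V z"
proof -
  have 1: "L_H Vt (\<lambda>z. g z * mu V z) z = (L_H Vt g z - rate U (fst z) (snd z) * g z) * mu V z"
    by (simp add: L_H_mult[OF g mu_C1(1)[OF V]] L_H_mu[OF V Vt] U_def algebra_simps)
  have 2: "mu V (bounce U z) = mu V z" by (simp add: mu_eq snd_bounce)
  have "gauss (snd z) * (g (fst z, w) * mu V (fst z, w)) = mu V z * (g (fst z, w) * gauss w)" for w
    by (simp add: gauss_def mu_eq)
  then have "(LINT w|lborel. gauss (snd z) * (g (fst z, w) * mu V (fst z, w))) = (LINT w|lborel. mu V z * (g (fst z, w) * gauss w))"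
    by (simp only:)
  then have 3: "gauss (snd z) * (LINT w|lborel. g (fst z, w) * mu V (fst z, w)) = mu V z * (LINT w|lborel. g (fst z, w) * gauss w)"
    by (simp only: integral_mult_right_zero)
  have 4: "rate U (fst z) (snd z) = rate_pos U (fst z) (snd z) - rate_neg U (fst z) (snd z)"
    by (auto simp: rate_pos_def rate_neg_def max_def)
  show ?thesis
    unfolding fokker_planck_def reversed_gen_def 1 2 3 L_Q_eq 4 by (simp add: algebra_simps)
qed

lemma continuous_on_L_Q:
  assumes g: "continuous_on UNIV g" "\<And>z. \<bar>g z\<bar> \<le> C"
  shows "continuous_on UNIV (L_Q lr g)"
proof -
  have "continuous_on UNIV (\<lambda>x. LINT w|lborel. g (x, w) * gauss w)"
  proof (rule continuous_on_parametric_integral[where B="\<lambda>w. C * gauss w"])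
    fix x :: 'a
    have "continuous_on UNIV (\<lambda>w. g (x, w))"
      by (rule continuous_on_compose2[OF g(1)]) (auto intro!: continuous_intros)
    then show "(\<lambda>w. g (x, w) * gauss w) \<in> borel_measurable lborel"
      by (auto intro!: borel_measurable_continuous_onI continuous_intros continuous_on_gauss)
    show "\<bar>g (x, w) * gauss w\<bar> \<le> C * gauss w" for w
      by (auto simp: abs_mult gauss_nonneg intro!: mult_right_mono g(2))
    show "continuous_on UNIV (\<lambda>x. g (x, w) * gauss w)" for w
      by (intro continuous_intros continuous_on_compose2[OF g(1)]) auto
  qed (simp add: integrable_gauss)
  then have "continuous_on UNIV (\<lambda>z. LINT w|lborel. g (fst z, w) * gauss w)"
    by (rule continuous_on_compose2) (auto intro!: continuous_intros)
  then show ?thesis unfolding L_Q_eq[abs_def] by (intro continuous_intros g(1))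
qed

lemma gen_star_adjoint:
  fixes V Vt :: "'a::euclidean_space \<Rightarrow> real"
  assumes V: "V \<in> C1" and Vt: "Vt \<in> C1" and mu: "integrable lborel (mu V)" and g: "g \<in> Cb2"
  defines "U \<equiv> \<lambda>x. V x - Vt x"
  shows "is_formal_adjoint (mu V) (gen V Vt lr) g (reversed_gen U Vt lr g)"
proof -
  have U: "U \<in> C1" unfolding U_def by (rule C1_diff(1)[OF V Vt])
  obtain C where C: "\<And>z. \<bar>g z\<bar> \<le> C" using Cb2_bounded[OF g] by blast
  have g1: "g \<in> C1" by (rule Cb2_C1[OF g])
  then have gc: "continuous_on UNIV g" by (rule C1_continuous)
  define G where "G z = g z * mu V z" for z
  have G1: "G \<in> C1" unfolding G_def by (rule C1_mult(1)[OF g1 mu_C1(1)[OF V]])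
  have Gi: "integrable lborel G"
    using integrable_mult_bounded[OF mu borel_measurable_continuous_onI[OF gc] C] by (simp add: G_def[abs_def] mult.commute)
  have FP: "fokker_planck U Vt lr G z = reversed_gen U Vt lr g z * mu V z" for z
    unfolding G_def U_def by (rule fokker_planck_mu[OF V Vt g1])
  have rb: "\<bar>rate_neg U (fst z) (snd z)\<bar> \<le> \<bar>rate U (fst z) (snd z)\<bar>" for z by (simp add: rate_neg_def)
  have "continuous_on UNIV (reversed_gen U Vt lr g)"
    unfolding reversed_gen_def[abs_def] right_diff_distrib
    by (intro continuous_intros continuous_on_L_H[OF Vt g1] continuous_on_L_Q[OF gc C] continuous_on_rate[OF U] gc
        continuous_on_rate_bounce[OF U _ rb gc C])
  moreover have "integrable lborel (\<lambda>z. gen V Vt lr f z * g z * mu V z)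
       \<and> integrable lborel (\<lambda>z. f z * reversed_gen U Vt lr g z * mu V z)
       \<and> (LINT z|lborel. gen V Vt lr f z * g z * mu V z) = (LINT z|lborel. f z * reversed_gen U Vt lr g z * mu V z)"
    if f: "f \<in> Cc2" for f
    using gen_dual[OF V Vt f G1 Gi, of lr] unfolding U_def[symmetric] FP by (simp add: G_def mult.assoc)
  ultimately show ?thesis unfolding is_formal_adjoint_def by blast
qed

lemma gen_star_eq:
  fixes V Vt :: "'a::euclidean_space \<Rightarrow> real"
  assumes "V \<in> C1" "Vt \<in> C1" "integrable lborel (mu V)" "g \<in> Cb2"
  shows "gen_star V Vt lr g = reversed_gen (\<lambda>x. V x - Vt x) Vt lr g"
  unfolding gen_star_def
  by (rule formal_adjoint_eqI[OF C1_continuous[OF mu_C1(1)] mu_pos gen_star_adjoint]) (use assms in auto)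

lemma gen_A_eq:
  fixes V Vt :: "'a::euclidean_space \<Rightarrow> real"
  assumes "V \<in> C1" "Vt \<in> C1" "integrable lborel (mu V)" "f \<in> Cb2"
  defines "U \<equiv> \<lambda>x. V x - Vt x"
  shows "gen_A V Vt lr f z = L_H Vt f z + rate U (fst z) (snd z) / 2 * (f (bounce U z) - f z)"
proof -
  have "rate_pos U (fst z) (snd z) = rate U (fst z) (snd z) + rate_neg U (fst z) (snd z)"
    by (auto simp: rate_pos_def rate_neg_def max_def)
  then show ?thesis
    by (simp add: gen_A_def gen_star_eq[OF assms(1-4)] gen_def reversed_gen_def L_R_eq U_def[symmetric] field_simps)
qed

lemma pos_schwartz_C1: "\<rho> \<in> pos_schwartz \<Longrightarrow> \<rho> \<in> C1"
  by (simp add: pos_schwartz_def schwartz_C1)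

lemma pos_schwartz_pos: "\<rho> \<in> pos_schwartz \<Longrightarrow> 0 < \<rho> z"
  by (simp add: pos_schwartz_def)

lemma pos_schwartz_decay:
  assumes "\<rho> \<in> pos_schwartz"
  obtains C where "0 \<le> C" "\<And>z. \<rho> z * (1 + norm z) ^ k \<le> C"
proof -
  obtain C where "0 \<le> C" "\<And>z. \<bar>\<rho> z\<bar> * (1 + norm z) ^ k \<le> C"
    using schwartz_decay[of \<rho> k] assms by (auto simp: pos_schwartz_def)
  then show ?thesis using that pos_schwartz_pos[OF assms] by (simp add: abs_of_pos)
qed

lemma pos_schwartz_integrable:
  fixes \<rho> :: "'b::euclidean_space \<Rightarrow> real"
  assumes "\<rho> \<in> pos_schwartz"
  shows "integrable lborel \<rho>"
proof -
  obtain C where C: "\<And>z. \<rho> z * (1 + norm z) ^ (DIM('b) + 2) \<le> C"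
    using pos_schwartz_decay[OF assms] by blast
  show ?thesis
    by (rule integrable_polynomial_decay[where C=C])
      (use C pos_schwartz_pos[OF assms] in \<open>auto simp: abs_of_pos intro!: borel_measurable_continuous_onI C1_continuous pos_schwartz_C1 assms\<close>)
qed

lemma pos_schwartz_bounded:
  assumes "\<rho> \<in> pos_schwartz"
  obtains C where "\<And>z. \<bar>\<rho> z\<bar> \<le> C"
proof -
  obtain C where "\<And>z. \<rho> z * (1 + norm z) ^ 0 \<le> C" using pos_schwartz_decay[OF assms] by blast
  then show ?thesis using that[of C] pos_schwartz_pos[OF assms] by (simp add: abs_of_pos)
qed

text \<open>The decay of \<open>\<rho>\<close> in \<open>w\<close> is uniform in \<open>x\<close>, which supplies the dominating function.\<close>

lemma continuous_on_marginal:
  fixes \<rho> :: "'b::euclidean_space \<times> 'c::euclidean_space \<Rightarrow> real"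
  assumes "\<rho> \<in> pos_schwartz"
  shows "continuous_on UNIV (\<lambda>x. LINT w|lborel. \<rho> (x, w))"
proof -
  define k where "k = DIM('c) + 2"
  obtain C where C: "0 \<le> C" "\<And>z. \<rho> z * (1 + norm z) ^ k \<le> C"
    using pos_schwartz_decay[OF assms] by blast
  have rc: "continuous_on UNIV \<rho>" by (intro C1_continuous pos_schwartz_C1 assms)
  have p: "0 < (1 + norm w) ^ k" for w :: 'c by (intro zero_less_power) (simp add: add_pos_nonneg)
  show ?thesis
  proof (rule continuous_on_parametric_integral[where B="\<lambda>w. C / (1 + norm w) ^ k"])
    have "continuous_on UNIV (\<lambda>w::'c. C / (1 + norm w) ^ k)"
      using p by (intro continuous_intros) (metis less_irrefl)
    moreover have "\<bar>C / (1 + norm w) ^ k\<bar> * (1 + norm w) ^ (DIM('c) + 2) \<le> C" for w :: 'c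
      unfolding k_def[symmetric] using p[of w] C(1) by (simp add: abs_of_nonneg less_imp_le)
    ultimately show "integrable lborel (\<lambda>w::'c. C / (1 + norm w) ^ k)"
      by (intro integrable_polynomial_decay[where C=C] borel_measurable_continuous_onI)
    fix x :: 'b
    have "continuous_on UNIV (\<lambda>w. \<rho> (x, w))"
      by (rule continuous_on_compose2[OF rc]) (auto intro!: continuous_intros)
    then show "(\<lambda>w. \<rho> (x, w)) \<in> borel_measurable lborel"
      by (auto intro!: borel_measurable_continuous_onI)
    show "\<bar>\<rho> (x, w)\<bar> \<le> C / (1 + norm w) ^ k" for w
    proof -
      have "norm w \<le> norm (x, w)" by (simp add: norm_prod_def real_le_rsqrt)
      then have "\<rho> (x, w) * (1 + norm w) ^ k \<le> \<rho> (x, w) * (1 + norm (x, w)) ^ k"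
        using pos_schwartz_pos[OF assms] by (intro mult_left_mono power_mono) (auto simp: less_imp_le)
      then show ?thesis
        using order_trans[OF _ C(2)[of "(x, w)"]] p[of w] pos_schwartz_pos[OF assms] by (simp add: abs_of_pos pos_le_divide_eq)
    qed
    show "continuous_on UNIV (\<lambda>x. \<rho> (x, w))" for w
      by (rule continuous_on_compose2[OF rc]) (auto intro!: continuous_intros)
  qed
qed

lemma gen'_adjoint:
  fixes V Vt :: "'a::euclidean_space \<Rightarrow> real"
  assumes V: "V \<in> C1" and Vt: "Vt \<in> C1" and \<rho>: "\<rho> \<in> pos_schwartz"
  defines "U \<equiv> \<lambda>x. V x - Vt x"
  shows "is_formal_adjoint (\<lambda>_. 1) (gen V Vt lr) \<rho> (fokker_planck U Vt lr \<rho>)"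
    and "gen' V Vt lr \<rho> = fokker_planck U Vt lr \<rho>"
proof -
  have U: "U \<in> C1" unfolding U_def by (rule C1_diff(1)[OF V Vt])
  obtain C where C: "\<And>z. \<bar>\<rho> z\<bar> \<le> C" using pos_schwartz_bounded[OF \<rho>] by blast
  note r1 = pos_schwartz_C1[OF \<rho>]
  have rc: "continuous_on UNIV \<rho>" using r1 by (rule C1_continuous)
  have rb: "\<bar>rate_neg U (fst z) (snd z)\<bar> \<le> \<bar>rate U (fst z) (snd z)\<bar>" for z by (simp add: rate_neg_def)
  have "continuous_on UNIV (fokker_planck U Vt lr \<rho>)"
    unfolding fokker_planck_def[abs_def]
    by (intro continuous_intros continuous_on_L_H[OF Vt r1] continuous_on_rate[OF U] rc
        continuous_on_rate_bounce[OF U _ rb rc C] continuous_on_compose2[OF continuous_on_marginal[OF \<rho>]]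
        continuous_on_compose2[OF continuous_on_gauss[of UNIV]]) auto
  then show *: "is_formal_adjoint (\<lambda>_. 1) (gen V Vt lr) \<rho> (fokker_planck U Vt lr \<rho>)"
    unfolding is_formal_adjoint_def
    using gen_dual[OF V Vt _ r1 pos_schwartz_integrable[OF \<rho>], of _ lr] by (simp add: U_def)
  show "gen' V Vt lr \<rho> = fokker_planck U Vt lr \<rho>"
    unfolding gen'_def by (rule formal_adjoint_eqI[OF _ _ *]) auto
qed

lemma W_tilde_adjoint:
  fixes V Vt :: "'a::euclidean_space \<Rightarrow> real"
  assumes V: "V \<in> C1" and Vt: "Vt \<in> C1" and mu: "integrable lborel (mu V)" and \<rho>: "\<rho> \<in> pos_schwartz"
  defines "U \<equiv> \<lambda>x. V x - Vt x"
  shows "is_formal_adjoint (\<lambda>_. 1) (gen_A V Vt lr) \<rho> (conservative_flow U Vt \<rho>)"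
    and "W_tilde V Vt lr \<rho> = conservative_flow U Vt \<rho>"
proof -
  have U: "U \<in> C1" unfolding U_def by (rule C1_diff(1)[OF V Vt])
  obtain C where C: "\<And>z. \<bar>\<rho> z\<bar> \<le> C" using pos_schwartz_bounded[OF \<rho>] by blast
  note r1 = pos_schwartz_C1[OF \<rho>]
  have rc: "continuous_on UNIV \<rho>" using r1 by (rule C1_continuous)
  define a where "a z = rate U (fst z) (snd z)" for z
  have a: "continuous_on UNIV a" unfolding a_def[abs_def] by (rule continuous_on_rate(1)[OF U])
  have rb: "\<bar>a z\<bar> \<le> \<bar>rate U (fst z) (snd z)\<bar>" for z by (simp add: a_def)
  have ab: "a (bounce U z) = - a z" for z by (simp add: a_def snd_bounce rate_bounce)
  have W: "conservative_flow U Vt \<rho> z = - L_H Vt \<rho> z - (a z * \<rho> (bounce U z)) / 2 - (a z * \<rho> z) / 2" for z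
    by (simp add: conservative_flow_def a_def field_simps)
  have "continuous_on UNIV (conservative_flow U Vt \<rho>)"
    unfolding W[abs_def]
    by (intro continuous_intros continuous_on_L_H[OF Vt r1] a rc continuous_on_rate_bounce[OF U a rb rc C]) auto
  moreover have "integrable lborel (\<lambda>z. gen_A V Vt lr f z * \<rho> z)
       \<and> integrable lborel (\<lambda>z. f z * conservative_flow U Vt \<rho> z)
       \<and> (LINT z|lborel. gen_A V Vt lr f z * \<rho> z) = (LINT z|lborel. f z * conservative_flow U Vt \<rho> z)"
    if f: "f \<in> Cc2" for f
  proof -
    obtain R where R: "\<And>z. z \<notin> cball 0 R \<Longrightarrow> f z = 0" using Cc2_support[OF f] by blast
    have f1: "f \<in> C1" by (rule Cb2_C1[OF Cc2_Cb2[OF f]])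
    have fc: "continuous_on UNIV f" using f1 by (rule C1_continuous)
    note H = L_H_integration_by_parts[OF Vt f1 r1 compact_cball[of 0 R] R]
    note B = bounce_dual[where R=R, OF U a rb fc R rc, unfolded ab]
    have fG: "integrable lborel (\<lambda>z. f z * (a z * \<rho> z))"
      by (rule integrable_compact_support[OF _ compact_cball[of 0 R]])
        (auto intro!: continuous_on_mult fc rc a simp: R)
    have l: "gen_A V Vt lr f z * \<rho> z = L_H Vt f z * \<rho> z + (1/2) * (a z * f (bounce U z) * \<rho> z) - (1/2) * (f z * (a z * \<rho> z))" for z
      unfolding gen_A_eq[OF V Vt mu Cc2_Cb2[OF f]] U_def[symmetric] a_def by (simp add: field_simps)
    have r: "f z * conservative_flow U Vt \<rho> z = - (f z * L_H Vt \<rho> z) + (1/2) * (f z * (- a z * \<rho> (bounce U z))) - (1/2) * (f z * (a z * \<rho> z))" for z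
      unfolding W by (simp add: field_simps)
    show ?thesis
      unfolding l r using H B fG
      by (simp add: Bochner_Integration.integral_add Bochner_Integration.integral_diff)
  qed
  ultimately show *: "is_formal_adjoint (\<lambda>_. 1) (gen_A V Vt lr) \<rho> (conservative_flow U Vt \<rho>)"
    unfolding is_formal_adjoint_def by simp
  show "W_tilde V Vt lr \<rho> = conservative_flow U Vt \<rho>"
    unfolding W_tilde_def by (rule formal_adjoint_eqI[OF _ _ *]) auto
qed

section \<open>Positivity and convexity of the dissipation potential\<close>

lemma ext_integral_nonneg:
  assumes "\<And>z. 0 \<le> f z"
  shows "ext_integral f = enn2ereal (\<integral>\<^sup>+z. ennreal (f z) \<partial>lborel)"
  by (simp add: ext_integral_def ennreal_neg assms zero_ennreal.rep_eq)

lemma ext_integral_integrable: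
  assumes f: "integrable lborel f"
  shows "ext_integral f = ereal (LINT z|lborel. f z)"
proof -
  have "(\<integral>\<^sup>+z. ennreal (f z) \<partial>lborel) \<noteq> top" "(\<integral>\<^sup>+z. ennreal (- f z) \<partial>lborel) \<noteq> top"
    using f by (auto simp: real_integrable_def)
  then obtain p n where "0 \<le> p" "(\<integral>\<^sup>+z. ennreal (f z) \<partial>lborel) = ennreal p"
    and "0 \<le> n" "(\<integral>\<^sup>+z. ennreal (- f z) \<partial>lborel) = ennreal n"
    by (metis ennreal_cases)
  then show ?thesis
    by (simp add: ext_integral_def real_lebesgue_integral_def[OF f])
qed

lemma ext_integral_convex_combination:
  assumes nonneg: "\<And>z. 0 \<le> f z" "\<And>z. 0 \<le> g z" "\<And>z. 0 \<le> h z"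
    and meas: "g \<in> borel_measurable borel" "h \<in> borel_measurable borel"
    and t: "0 \<le> t" "t \<le> 1" and le: "\<And>z. f z \<le> (1 - t) * g z + t * h z"
  shows "ext_integral f \<le> ereal (1 - t) * ext_integral g + ereal t * ext_integral h"
proof -
  have [measurable]: "g \<in> borel_measurable lborel" "h \<in> borel_measurable lborel" using meas by simp_all
  have "(\<integral>\<^sup>+z. ennreal (f z) \<partial>lborel) \<le> (\<integral>\<^sup>+z. ennreal (1 - t) * ennreal (g z) + ennreal t * ennreal (h z) \<partial>lborel)"
  proof (rule nn_integral_mono)
    fix z
    have "ennreal (f z) \<le> ennreal ((1 - t) * g z + t * h z)" using le by (rule ennreal_leI)
    also have "\<dots> = ennreal (1 - t) * ennreal (g z) + ennreal t * ennreal (h z)"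
      using t nonneg by (simp add: ennreal_plus ennreal_mult)
    finally show "ennreal (f z) \<le> ennreal (1 - t) * ennreal (g z) + ennreal t * ennreal (h z)" .
  qed
  also have "\<dots> = ennreal (1 - t) * (\<integral>\<^sup>+z. ennreal (g z) \<partial>lborel) + ennreal t * (\<integral>\<^sup>+z. ennreal (h z) \<partial>lborel)"
    by (simp add: nn_integral_add nn_integral_cmult)
  finally show ?thesis
    unfolding ext_integral_nonneg[OF nonneg(1)] ext_integral_nonneg[OF nonneg(2)] ext_integral_nonneg[OF nonneg(3)]
      less_eq_ennreal.rep_eq plus_ennreal.rep_eq times_ennreal.rep_eq
    using t by simp
qed

lemma ext_integral_ge_0: "(\<And>z. 0 \<le> f z) \<Longrightarrow> 0 \<le> ext_integral f"
  by (simp add: ext_integral_nonneg)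

lemma cosh_convex_combination:
  fixes a b t :: real
  assumes "0 \<le> t" "t \<le> 1"
  shows "cosh ((1 - t) * a + t * b) \<le> (1 - t) * cosh a + t * cosh b"
proof -
  have *: "exp ((1 - t) * x + t * y) \<le> (1 - t) * exp x + t * exp y" for x y :: real
    using convex_onD[OF exp_convex, of t x y] assms by simp
  have e: "- ((1 - t) * a + t * b) = (1 - t) * (- a) + t * (- b)" by simp
  show ?thesis
    unfolding cosh_field_def e using *[of a b] *[of "- a" "- b"] by (simp add: field_simps)
qed

text \<open>The common form of the two summands of the potential: jumps from \<open>m y\<close> to \<open>m' y\<close>, weighted by \<open>c\<close>.\<close>

lemma jump_dissipation_convex:
  fixes c :: "'b::euclidean_space \<Rightarrow> real" and m m' :: "'b \<Rightarrow> 'c::euclidean_space"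
  defines "I \<equiv> \<lambda>\<xi>. ext_integral (\<lambda>y. c y * (cosh (\<xi> (m' y) - \<xi> (m y)) - 1))"
  assumes c: "c \<in> borel_measurable borel" "\<And>y. 0 \<le> c y"
    and m: "m \<in> borel_measurable borel" "m' \<in> borel_measurable borel"
    and xi: "\<xi> \<in> borel_measurable borel" "\<eta> \<in> borel_measurable borel" and t: "0 \<le> t" "t \<le> 1"
  shows "I (\<lambda>z. (1 - t) * \<xi> z + t * \<eta> z) \<le> ereal (1 - t) * I \<xi> + ereal t * I \<eta>"
  unfolding I_def
proof (rule ext_integral_convex_combination[OF _ _ _ _ _ t])
  have cosh1: "0 \<le> cosh x - 1" for x :: real using cosh_real_ge_1[of x] by simp
  note [measurable] = c(1) m xi
  have [measurable]: "(cosh :: real \<Rightarrow> real) \<in> borel_measurable borel"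
    by (intro borel_measurable_continuous_onI continuous_intros)
  show "(\<lambda>y. c y * (cosh (\<xi> (m' y) - \<xi> (m y)) - 1)) \<in> borel_measurable borel"
    "(\<lambda>y. c y * (cosh (\<eta> (m' y) - \<eta> (m y)) - 1)) \<in> borel_measurable borel"
    by measurable
  have nn: "0 \<le> c y * (cosh (\<zeta> (m' y) - \<zeta> (m y)) - 1)" for \<zeta> y
    by (intro mult_nonneg_nonneg c(2) cosh1)
  show "0 \<le> c y * (cosh (((1 - t) * \<xi> (m' y) + t * \<eta> (m' y)) - ((1 - t) * \<xi> (m y) + t * \<eta> (m y))) - 1)"
    "0 \<le> c y * (cosh (\<xi> (m' y) - \<xi> (m y)) - 1)" "0 \<le> c y * (cosh (\<eta> (m' y) - \<eta> (m y)) - 1)" for y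
    by (rule nn nn[of y "\<lambda>z. (1 - t) * \<xi> z + t * \<eta> z"])+
  fix y
  have "cosh ((1 - t) * (\<xi> (m' y) - \<xi> (m y)) + t * (\<eta> (m' y) - \<eta> (m y))) - 1
      \<le> (1 - t) * (cosh (\<xi> (m' y) - \<xi> (m y)) - 1) + t * (cosh (\<eta> (m' y) - \<eta> (m y)) - 1)"
    using cosh_convex_combination[OF t, of "\<xi> (m' y) - \<xi> (m y)" "\<eta> (m' y) - \<eta> (m y)"] by (simp add: algebra_simps)
  from mult_left_mono[OF this c(2)[of y]]
  show "c y * (cosh (((1 - t) * \<xi> (m' y) + t * \<eta> (m' y)) - ((1 - t) * \<xi> (m y) + t * \<eta> (m y))) - 1)
      \<le> (1 - t) * (c y * (cosh (\<xi> (m' y) - \<xi> (m y)) - 1)) + t * (c y * (cosh (\<eta> (m' y) - \<eta> (m y)) - 1))"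
    by (simp add: algebra_simps)
qed

definition thermal_weight :: "('a::euclidean_space \<times> 'a \<Rightarrow> real) \<Rightarrow> 'a \<times> 'a \<times> 'a \<Rightarrow> real" where
  "thermal_weight \<rho> y = exp (- ((norm (fst (snd y)))\<^sup>2 + (norm (snd (snd y)))\<^sup>2) / 4)
     * sqrt (\<rho> (fst y, fst (snd y)) * \<rho> (fst y, snd (snd y)))"

lemma psi_eq:
  fixes \<rho> :: "'a::euclidean_space \<times> 'a \<Rightarrow> real"
  shows "psi lr \<rho> \<xi> = ereal (lr / (2 * pi) powr (real DIM('a) / 2)) *
    ext_integral (\<lambda>y. thermal_weight \<rho> y * (cosh (\<xi> (fst y, snd (snd y)) - \<xi> (fst y, fst (snd y))) - 1))"
  unfolding psi_def thermal_weight_def by (intro arg_cong2[where f="(*)"] refl arg_cong[where f=ext_integral]) (auto simp: fun_eq_iff)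

definition bounce_weight :: "('a::euclidean_space \<Rightarrow> real) \<Rightarrow> ('a \<times> 'a \<Rightarrow> real) \<Rightarrow> 'a \<times> 'a \<Rightarrow> real" where
  "bounce_weight U \<rho> z = \<bar>rate U (fst z) (snd z)\<bar> * sqrt (\<rho> z * \<rho> (bounce U z))"

lemma psi_hat_eq:
  "psi_hat U \<rho> \<xi> = ereal (1 / 2) *
    ext_integral (\<lambda>z. bounce_weight U \<rho> z * (cosh (\<xi> (bounce U z) - \<xi> z) - 1))"
  unfolding psi_hat_def bounce_weight_def
  by (intro arg_cong2[where f="(*)"] refl arg_cong[where f=ext_integral])
    (auto simp: fun_eq_iff bounce_def rate_pos_def rate_neg_def max_def mult.commute)

lemma thermal_weight_measurable_nonneg:
  fixes \<rho> :: "'a::euclidean_space \<times> 'a \<Rightarrow> real"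
  assumes "\<rho> \<in> pos_schwartz"
  shows "thermal_weight \<rho> \<in> borel_measurable borel" "0 \<le> thermal_weight \<rho> y"
proof -
  have rc: "continuous_on UNIV \<rho>" by (intro C1_continuous pos_schwartz_C1 assms)
  have "continuous_on UNIV (thermal_weight \<rho>)"
    unfolding thermal_weight_def[abs_def]
    by (intro continuous_intros continuous_on_compose2[OF rc]) auto
  then show "thermal_weight \<rho> \<in> borel_measurable borel" by (rule borel_measurable_continuous_onI)
  show "0 \<le> thermal_weight \<rho> y"
    using pos_schwartz_pos[OF assms] by (simp add: thermal_weight_def less_imp_le)
qed

lemma bounce_weight_measurable_nonneg:
  fixes \<rho> :: "'a::euclidean_space \<times> 'a \<Rightarrow> real"
  assumes "\<rho> \<in> pos_schwartz" and U: "U \<in> C1"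
  shows "bounce_weight U \<rho> \<in> borel_measurable borel" "0 \<le> bounce_weight U \<rho> y"
proof -
  have [measurable]: "\<rho> \<in> borel_measurable borel"
    by (intro borel_measurable_continuous_onI C1_continuous pos_schwartz_C1 assms)
  have [measurable]: "(\<lambda>z. rate U (fst z) (snd z)) \<in> borel_measurable borel"
    by (intro borel_measurable_continuous_onI continuous_on_rate U)
  note [measurable] = borel_measurable_bounce[OF U]
  show "bounce_weight U \<rho> \<in> borel_measurable borel"
    unfolding bounce_weight_def[abs_def] by measurable
  show "0 \<le> bounce_weight U \<rho> y"
    using pos_schwartz_pos[OF assms(1)] by (simp add: bounce_weight_def less_imp_le)
qed

lemma psi_tilde_nonneg:
  assumes "\<rho> \<in> pos_schwartz" "(\<lambda>x. V x - Vt x) \<in> C1" "0 \<le> lr"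
  shows "0 \<le> psi lr \<rho> \<xi>" "0 \<le> psi_hat (\<lambda>x. V x - Vt x) \<rho> \<xi>" "0 \<le> psi_tilde V Vt lr \<rho> \<xi>"
proof -
  have cosh1: "0 \<le> cosh x - 1" for x :: real using cosh_real_ge_1[of x] by simp
  show 1: "0 \<le> psi lr \<rho> \<xi>"
    unfolding psi_eq using assms(3)
    by (intro ereal_0_le_mult ext_integral_ge_0 mult_nonneg_nonneg thermal_weight_measurable_nonneg[OF assms(1)] cosh1) simp
  show 2: "0 \<le> psi_hat (\<lambda>x. V x - Vt x) \<rho> \<xi>"
    unfolding psi_hat_eq
    by (intro ereal_0_le_mult ext_integral_ge_0 mult_nonneg_nonneg bounce_weight_measurable_nonneg[OF assms(1,2)] cosh1) simp
  show "0 \<le> psi_tilde V Vt lr \<rho> \<xi>"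
    unfolding psi_tilde_def using 1 2 by simp
qed

lemma ereal_scaled_convex_combination:
  fixes X Y Z :: ereal
  assumes "X \<le> ereal (1 - t) * Y + ereal t * Z" "0 \<le> c"
  shows "ereal c * X \<le> ereal (1 - t) * (ereal c * Y) + ereal t * (ereal c * Z)"
proof -
  have "ereal c * X \<le> ereal c * (ereal (1 - t) * Y + ereal t * Z)"
    using assms by (intro ereal_mult_left_mono) auto
  also have "\<dots> = ereal c * (ereal (1 - t) * Y) + ereal c * (ereal t * Z)"
    using assms(2) by (intro ereal_pos_distrib) auto
  finally show ?thesis by (simp add: mult.left_commute)
qed

lemma psi_tilde_convex:
  fixes \<rho> :: "'a::euclidean_space \<times> 'a \<Rightarrow> real"
  assumes \<rho>: "\<rho> \<in> pos_schwartz" and U: "(\<lambda>x. V x - Vt x) \<in> C1" and lr: "0 \<le> lr"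
    and xi: "\<xi> \<in> borel_measurable borel" "\<eta> \<in> borel_measurable borel" and t: "0 \<le> t" "t \<le> 1"
  shows "psi_tilde V Vt lr \<rho> (\<lambda>z. (1 - t) * \<xi> z + t * \<eta> z)
      \<le> ereal (1 - t) * psi_tilde V Vt lr \<rho> \<xi> + ereal t * psi_tilde V Vt lr \<rho> \<eta>"
proof -
  define U where "U = (\<lambda>x. V x - Vt x)"
  let ?\<zeta> = "\<lambda>z. (1 - t) * \<xi> z + t * \<eta> z"
  have m: "(\<lambda>y::'a \<times> 'a \<times> 'a. (fst y, fst (snd y))) \<in> borel_measurable borel"
    "(\<lambda>y::'a \<times> 'a \<times> 'a. (fst y, snd (snd y))) \<in> borel_measurable borel"
    by (intro borel_measurable_continuous_onI continuous_intros)+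
  have 1: "psi lr \<rho> ?\<zeta> \<le> ereal (1 - t) * psi lr \<rho> \<xi> + ereal t * psi lr \<rho> \<eta>"
    unfolding psi_eq using lr
    by (intro ereal_scaled_convex_combination jump_dissipation_convex[OF thermal_weight_measurable_nonneg[OF \<rho>] m xi t]) auto
  have id: "(\<lambda>z::'a \<times> 'a. z) \<in> borel_measurable borel" by simp
  have 2: "psi_hat U \<rho> ?\<zeta> \<le> ereal (1 - t) * psi_hat U \<rho> \<xi> + ereal t * psi_hat U \<rho> \<eta>"
    unfolding psi_hat_eq
    by (intro ereal_scaled_convex_combination
        jump_dissipation_convex[OF bounce_weight_measurable_nonneg[OF \<rho>] id borel_measurable_bounce xi t]) (use U in \<open>auto simp: U_def\<close>)
  have d: "ereal s * psi_tilde V Vt lr \<rho> \<zeta> = ereal s * psi lr \<rho> \<zeta> + ereal s * psi_hat U \<rho> \<zeta>" if "0 \<le> s" for s \<zeta>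
    unfolding psi_tilde_def U_def[symmetric] using that by (intro ereal_pos_distrib) auto
  have "psi_tilde V Vt lr \<rho> ?\<zeta> \<le> (ereal (1 - t) * psi lr \<rho> \<xi> + ereal t * psi lr \<rho> \<eta>)
      + (ereal (1 - t) * psi_hat U \<rho> \<xi> + ereal t * psi_hat U \<rho> \<eta>)"
    unfolding psi_tilde_def U_def[symmetric] by (intro add_mono 1 2)
  also have "\<dots> = ereal (1 - t) * psi_tilde V Vt lr \<rho> \<xi> + ereal t * psi_tilde V Vt lr \<rho> \<eta>"
    using t by (simp add: d ac_simps)
  finally show ?thesis .
qed

section \<open>Derivative of the dissipation potential\<close>

text \<open>The identity behind the gradient structure: at half the logarithmic ratio of the fluxes \<open>A\<close> and \<open>B\<close>,
their geometric mean times \<open>exp\<close> of that force is one flux, and times its inverse the other.\<close>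

lemma sqrt_mult_cosh:
  assumes "0 < A" "0 < B"
  shows "sqrt (A * B) * (cosh ((ln A - ln B) / 2 + s) - 1) = A / 2 * exp s + B / 2 * exp (- s) - sqrt (A * B)"
proof -
  have A: "exp (ln A / 2) = sqrt A" and B: "exp (ln B / 2) = sqrt B"
    using assms by (simp_all add: powr_half_sqrt[symmetric] powr_def)
  have 1: "exp ((ln A - ln B) / 2 + s) = sqrt A / sqrt B * exp s"
    unfolding exp_add diff_divide_distrib exp_diff A B by simp
  have "- ((ln A - ln B) / 2 + s) = (ln B / 2 - ln A / 2) + - s" by (simp add: field_simps)
  then have 2: "exp (- ((ln A - ln B) / 2 + s)) = sqrt B / sqrt A * exp (- s)"
    by (simp only: exp_add exp_diff A B)
  have "sqrt A * sqrt A = A" "sqrt B * sqrt B = B" using assms by simp_all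
  then have 3: "sqrt (A * B) * (sqrt A / sqrt B) = A" "sqrt (A * B) * (sqrt B / sqrt A) = B"
    using assms by (simp_all add: real_sqrt_mult)
  have "sqrt (A * B) * (cosh ((ln A - ln B) / 2 + s) - 1)
      = (sqrt (A * B) * (sqrt A / sqrt B)) / 2 * exp s + (sqrt (A * B) * (sqrt B / sqrt A)) / 2 * exp (- s) - sqrt (A * B)"
    unfolding cosh_field_def 1 2 by (simp add: field_simps)
  then show ?thesis unfolding 3 .
qed

text \<open>The jump \<open>y\<close> has flux \<open>A y\<close> and reversal \<open>T y\<close>, and \<open>\<delta>\<close> is the increment of the direction along it.
The derivative at zero is the integral of \<open>(A y - A (T y)) \<delta> y / 2\<close>; substituting \<open>T y\<close> in the
second half shows that both halves are equal.\<close>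

lemma reversible_jump_derivative:
  fixes A \<delta> :: "'b::euclidean_space \<Rightarrow> real" and T :: "'b \<Rightarrow> 'b"
  assumes T: "distr lborel borel T = lborel" "T \<in> borel_measurable borel" "\<And>y. T (T y) = y"
    and A: "integrable lborel A" "\<And>y. 0 \<le> A y"
    and \<delta>: "\<delta> \<in> borel_measurable borel" "\<And>y. \<bar>\<delta> y\<bar> \<le> C" "\<And>y. \<delta> (T y) = - \<delta> y"
  defines "J \<equiv> \<lambda>\<epsilon> y. A y / 2 * exp (\<epsilon> * \<delta> y) + A (T y) / 2 * exp (- (\<epsilon> * \<delta> y)) - sqrt (A y * A (T y))"
  shows "integrable lborel (J \<epsilon>)" and "integrable lborel (\<lambda>y. A y * \<delta> y)"
    and "((\<lambda>\<epsilon>. LINT y|lborel. J \<epsilon> y) has_real_derivative (LINT y|lborel. A y * \<delta> y)) (at 0)"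
proof -
  define B where "B y = A (T y)" for y
  have B: "integrable lborel B" "\<And>y. 0 \<le> B y"
    using lborel_preserving_integral(1)[OF T(1,2) A(1)] A(2) by (simp_all add: B_def[abs_def])
  have [measurable]: "A \<in> borel_measurable borel" "B \<in> borel_measurable borel" 
    using borel_measurable_integrable[OF A(1)] borel_measurable_integrable[OF B(1)] by simp_all
  note [measurable] = \<delta>(1)
  have C: "0 \<le> C" using order_trans[OF abs_ge_zero \<delta>(2)] .
  have ebound: "\<bar>exp (e * \<delta> y)\<bar> \<le> exp (\<bar>e\<bar> * C)" for e y
  proof -
    have "e * \<delta> y \<le> \<bar>e * \<delta> y\<bar>" by simp
    also have "\<dots> \<le> \<bar>e\<bar> * C" unfolding abs_mult by (intro mult_left_mono \<delta>(2)) simp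
    finally show ?thesis by simp
  qed
  have intexp: "integrable lborel (\<lambda>y. X y * exp (e * \<delta> y))" if "integrable lborel X" for X e
    by (rule integrable_mult_bounded[OF that _ ebound]) simp
  have intsqrt: "integrable lborel (\<lambda>y. sqrt (A y * B y))"
  proof (rule Bochner_Integration.integrable_bound)
    show "integrable lborel (\<lambda>y. (A y + B y) / 2)" using A B by simp
    show "AE y in lborel. norm (sqrt (A y * B y)) \<le> norm ((A y + B y) / 2)"
    proof (rule AE_I2)
      fix y
      have "sqrt (A y * B y) \<le> (A y + B y) / 2" by (rule arith_geo_mean_sqrt[OF A(2) B(2)])
      then show "norm (sqrt (A y * B y)) \<le> norm ((A y + B y) / 2)" using A(2)[of y] B(2)[of y] by simp
    qed
  qed simp
  have Jeq: "J e y = (1/2) * (A y * exp (e * \<delta> y)) + (1/2) * (B y * exp ((- e) * \<delta> y)) - sqrt (A y * B y)" for e y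
    by (simp add: J_def B_def)
  have intJ: "integrable lborel (J e)" for e
    unfolding Jeq[abs_def]
    by (intro Bochner_Integration.integrable_add Bochner_Integration.integrable_diff integrable_mult_right intexp A B intsqrt)
  then show "integrable lborel (J \<epsilon>)" .
  show Ad: "integrable lborel (\<lambda>y. A y * \<delta> y)" by (rule integrable_mult_bounded[OF A(1) \<delta>(1,2)])
  have Bd: "integrable lborel (\<lambda>y. B y * \<delta> y)" by (rule integrable_mult_bounded[OF B(1) \<delta>(1,2)])
  define J' where "J' e y = (1/2) * (A y * (exp (e * \<delta> y) * \<delta> y)) - (1/2) * (B y * (exp ((- e) * \<delta> y) * \<delta> y))" for e y
  have der: "((\<lambda>s. J s y) has_real_derivative J' e y) (at e)" for e y
    unfolding Jeq J'_def by (auto intro!: derivative_eq_intros simp: mult_ac)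
  have bnd: "\<bar>J' e y\<bar> \<le> (A y + B y) * (exp C * C)" if "\<bar>e\<bar> < 1" for e y
  proof -
    have x: "\<bar>exp (s * \<delta> y) * \<delta> y\<bar> \<le> exp C * C" if "\<bar>s\<bar> < 1" for s
    proof -
      have "exp (\<bar>s\<bar> * C) \<le> exp C" using that C by (simp add: mult_left_le_one_le)
      then have "\<bar>exp (s * \<delta> y)\<bar> \<le> exp C" using ebound[of s y] by simp
      then show ?thesis unfolding abs_mult using \<delta>(2) by (intro mult_mono) auto
    qed
    have "\<bar>J' e y\<bar> \<le> (1/2) * \<bar>A y * (exp (e * \<delta> y) * \<delta> y)\<bar> + (1/2) * \<bar>B y * (exp ((- e) * \<delta> y) * \<delta> y)\<bar>"
      unfolding J'_def by (rule order_trans[OF abs_triangle_ineq4]) (simp add: abs_mult)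
    also have "\<dots> \<le> (1/2) * (A y * (exp C * C)) + (1/2) * (B y * (exp C * C))"
      unfolding abs_mult[of "A y"] abs_mult[of "B y"]
      using x[of e] x[of "- e"] that A(2)[of y] B(2)[of y]
      by (intro add_mono mult_left_mono[where c="1/2"]) (auto intro!: mult_left_mono)
    also have "\<dots> \<le> (A y + B y) * (exp C * C)"
      using A(2)[of y] B(2)[of y] C by (simp add: field_simps)
    finally show ?thesis .
  qed
  have "((\<lambda>\<epsilon>. LINT y|lborel. J \<epsilon> y) has_real_derivative (LINT y|lborel. J' 0 y)) (at 0)"
    by (rule has_real_derivative_integral(2)[where d=1 and B="\<lambda>y. (A y + B y) * (exp C * C)"])
      (use intJ der bnd A B in auto)
  moreover have "(LINT y|lborel. J' 0 y) = (LINT y|lborel. A y * \<delta> y)"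
  proof -
    have "(LINT y|lborel. B y * \<delta> y) = (LINT y|lborel. A (T (T y)) * \<delta> (T y))"
      using lborel_preserving_integral(2)[OF T(1,2) Bd] by (simp add: B_def)
    then have "(LINT y|lborel. B y * \<delta> y) = - (LINT y|lborel. A y * \<delta> y)"
      by (simp add: T(3) \<delta>(3))
    then show ?thesis unfolding J'_def using Ad Bd by simp
  qed
  ultimately show "((\<lambda>\<epsilon>. LINT y|lborel. J \<epsilon> y) has_real_derivative (LINT y|lborel. A y * \<delta> y)) (at 0)"
    by simp
qed

text \<open>The derivative of the dissipation potential at minus half of the entropy derivative.\<close>

definition dissipation :: "('a::euclidean_space \<Rightarrow> real) \<Rightarrow> real \<Rightarrow>
    ('a \<times> 'a \<Rightarrow> real) \<Rightarrow> 'a \<times> 'a \<Rightarrow> real" where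
  "dissipation U lr \<rho> z = lr * (gauss (snd z) * (LINT w|lborel. \<rho> (fst z, w)) - \<rho> z)
     + \<bar>rate U (fst z) (snd z)\<bar> / 2 * (\<rho> (bounce U z) - \<rho> z)"

lemma fokker_planck_decomposition:
  "fokker_planck U Vt lr \<rho> z = conservative_flow U Vt \<rho> z + dissipation U lr \<rho> z"
proof -
  have *: "rate_pos U (fst z) (snd z) = (\<bar>rate U (fst z) (snd z)\<bar> + rate U (fst z) (snd z)) / 2"
    "rate_neg U (fst z) (snd z) = (\<bar>rate U (fst z) (snd z)\<bar> - rate U (fst z) (snd z)) / 2"
    by (auto simp: rate_pos_def rate_neg_def max_def)
  show ?thesis
    unfolding fokker_planck_def conservative_flow_def dissipation_def * by (simp add: field_simps)
qed

text \<open>Here a jump is a triple \<open>(x, v, v')\<close>, its flux is \<open>\<rho> (x, v) \<gamma> v'\<close> and reversal exchanges the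
velocities. In the increment of \<open>- d_entropy / 2\<close> the term \<open>Vh x\<close> cancels, and the kinetic energies
turn \<open>ln \<rho>\<close> into the logarithms of the fluxes.\<close>

lemma psi_derivative:
  fixes \<rho> g :: "'a::euclidean_space \<times> 'a \<Rightarrow> real" and lr :: real
  assumes \<rho>: "\<rho> \<in> pos_schwartz" and g: "continuous_on UNIV g" "\<And>z. \<bar>g z\<bar> \<le> C"
  defines "Q \<equiv> \<lambda>z. lr * (gauss (snd z) * (LINT w|lborel. \<rho> (fst z, w)) - \<rho> z)"
  shows "integrable lborel (\<lambda>z. Q z * g z)"
    and "\<exists>\<Phi>. (\<forall>\<epsilon>. psi lr \<rho> (\<lambda>z. - d_entropy Vh \<rho> z / 2 + \<epsilon> * g z) = ereal (\<Phi> \<epsilon>))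
      \<and> (\<Phi> has_real_derivative (LINT z|lborel. Q z * g z)) (at 0)"
proof -
  note ri = pos_schwartz_integrable[OF \<rho>]
  note rp = pos_schwartz_pos[OF \<rho>]
  define T where "T y = (fst y, snd (snd y), fst (snd y))" for y :: "'a \<times> 'a \<times> 'a"
  define A where "A y = \<rho> (fst y, fst (snd y)) * gauss (snd (snd y))" for y :: "'a \<times> 'a \<times> 'a"
  define \<delta> where "\<delta> y = g (fst y, snd (snd y)) - g (fst y, fst (snd y))" for y
  have cm: "continuous_on UNIV (\<lambda>y::'a \<times> 'a \<times> 'a. g (fst y, snd (snd y)))"
    "continuous_on UNIV (\<lambda>y::'a \<times> 'a \<times> 'a. g (fst y, fst (snd y)))"
    by (intro continuous_on_compose2[OF g(1)] continuous_intros; auto)+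
  note bm = cm[THEN borel_measurable_continuous_onI]
  have one: "(\<lambda>y. 1) \<in> borel_measurable borel" "\<bar>1::real\<bar> \<le> 1" by simp_all
  have T: "distr lborel borel T = lborel" "T \<in> borel_measurable borel" "T (T y) = y" for y
    unfolding T_def[abs_def] by (rule lborel_distr_swap_velocities) 
      (auto intro!: borel_measurable_continuous_onI continuous_intros)
  have A: "integrable lborel A" "0 \<le> A y" for y
    using triple_integral(1)[OF ri one] rp by (simp_all add: A_def[abs_def] less_imp_le gauss_nonneg)
  have \<delta>: "\<delta> \<in> borel_measurable borel" "\<bar>\<delta> y\<bar> \<le> 2 * C" "\<delta> (T y) = - \<delta> y" for y
  proof -
    show "\<delta> \<in> borel_measurable borel" unfolding \<delta>_def[abs_def] using bm by simp
    show "\<bar>\<delta> y\<bar> \<le> 2 * C"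
      using g(2)[of "(fst y, snd (snd y))"] g(2)[of "(fst y, fst (snd y))"] by (simp add: \<delta>_def)
    show "\<delta> (T y) = - \<delta> y" by (simp add: \<delta>_def T_def)
  qed
  note R = reversible_jump_derivative[OF T A \<delta>]
  define J where "J \<epsilon> y = A y / 2 * exp (\<epsilon> * \<delta> y) + A (T y) / 2 * exp (- (\<epsilon> * \<delta> y)) - sqrt (A y * A (T y))" for \<epsilon> y
  \<comment> \<open>The normalising constant of the Gaussian, which cancels against the prefactor of \<open>psi\<close>.\<close>
  define K where "K = (2 * pi) powr (real DIM('a) / 2)"
  have K: "0 < K" by (simp add: K_def)
  have gK: "gauss v = exp (- (norm v)\<^sup>2 / 2) / K" for v :: 'a
    unfolding gauss_def K_def powr_minus by (simp add: field_simps)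
  have ln_gauss: "ln (gauss v) = - (norm v)\<^sup>2 / 2 - ln K" for v :: 'a
    using K by (simp add: gK ln_div)
  have wt: "thermal_weight \<rho> y = K * sqrt (A y * A (T y))" for y
  proof -
    let ?r = "\<rho> (fst y, fst (snd y))" and ?r' = "\<rho> (fst y, snd (snd y))"
    let ?e = "exp (- ((norm (fst (snd y)))\<^sup>2 + (norm (snd (snd y)))\<^sup>2) / 4)"
    have "?e ^ 2 = exp (- (norm (fst (snd y)))\<^sup>2 / 2) * exp (- (norm (snd (snd y)))\<^sup>2 / 2)"
      by (simp add: exp_double[symmetric] exp_add[symmetric] field_simps)
    then have "A y * A (T y) = (?e / K) ^ 2 * (?r * ?r')"
      by (simp add: A_def T_def gK power_divide) (simp add: power2_eq_square)
    then have "sqrt (A y * A (T y)) = ?e / K * sqrt (?r * ?r')"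
      using K by (simp add: real_sqrt_mult)
    then show ?thesis using K by (simp add: thermal_weight_def)
  qed
  have psi: "psi lr \<rho> (\<lambda>z. - d_entropy Vh \<rho> z / 2 + \<epsilon> * g z) = ereal (lr * (LINT y|lborel. J \<epsilon> y))" for \<epsilon>
  proof -
    let ?\<xi> = "\<lambda>z. - d_entropy Vh \<rho> z / 2 + \<epsilon> * g z"
    have "thermal_weight \<rho> y * (cosh (?\<xi> (fst y, snd (snd y)) - ?\<xi> (fst y, fst (snd y))) - 1) = K * J \<epsilon> y" for y
    proof -
      have "?\<xi> (fst y, snd (snd y)) - ?\<xi> (fst y, fst (snd y)) = (ln (A y) - ln (A (T y))) / 2 + \<epsilon> * \<delta> y"
        by (simp add: d_entropy_def A_def T_def ln_mult_pos[OF rp gauss_pos] ln_gauss \<delta>_def) (simp add: field_simps)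
      moreover have "0 < A y" "0 < A (T y)" by (simp_all add: A_def T_def mult_pos_pos[OF rp gauss_pos])
      ultimately show ?thesis
        unfolding wt J_def mult.assoc by (simp only: sqrt_mult_cosh)
    qed
    then have "psi lr \<rho> ?\<xi> = ereal (lr / K) * ext_integral (\<lambda>y. K * J \<epsilon> y)"
      unfolding psi_eq K_def[symmetric] by (simp only:)
    also have "integrable lborel (J \<epsilon>)" unfolding J_def[abs_def] by (rule R(1))
    then have "ext_integral (\<lambda>y. K * J \<epsilon> y) = ereal (K * (LINT y|lborel. J \<epsilon> y))"
      by (subst ext_integral_integrable) simp_all
    finally show ?thesis using K by simp
  qed
  note T1 = triple_integral[OF ri bm(1) g(2)]
  note T2 = triple_integral[OF ri bm(2) g(2)]
  have iQ1: "integrable lborel (\<lambda>z. gauss (snd z) * (LINT w|lborel. \<rho> (fst z, w)) * g z)"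
    using T1(5) by (simp add: mult_ac)
  have iQ2: "integrable lborel (\<lambda>z. \<rho> z * g z)"
    using T2(3) by (simp add: integral_gauss)
  have Q: "Q z * g z = lr * (gauss (snd z) * (LINT w|lborel. \<rho> (fst z, w)) * g z) - lr * (\<rho> z * g z)" for z
    by (simp add: Q_def algebra_simps)
  show "integrable lborel (\<lambda>z. Q z * g z)" unfolding Q using iQ1 iQ2 by simp
  have "(LINT y|lborel. A y * \<delta> y) = (LINT z|lborel. gauss (snd z) * (LINT w|lborel. \<rho> (fst z, w)) * g z) - (LINT z|lborel. \<rho> z * g z)"
  proof -
    have "(LINT y|lborel. A y * \<delta> y) = (LINT y|lborel. A y * g (fst y, snd (snd y))) - (LINT y|lborel. A y * g (fst y, fst (snd y)))"
      unfolding \<delta>_def right_diff_distrib using T1(1) T2(1) by (simp add: A_def)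
    also have "(LINT y|lborel. A y * g (fst y, snd (snd y))) = (LINT z|lborel. gauss (snd z) * (LINT w|lborel. \<rho> (fst z, w)) * g z)"
      using T1(4) by (simp add: A_def mult_ac)
    also have "(LINT y|lborel. A y * g (fst y, fst (snd y))) = (LINT z|lborel. \<rho> z * g z)"
      using T2(2) by (simp add: A_def integral_gauss)
    finally show ?thesis .
  qed
  then have "(LINT z|lborel. Q z * g z) = lr * (LINT y|lborel. A y * \<delta> y)"
    unfolding Q using iQ1 iQ2 by (simp add: right_diff_distrib)
  then have "((\<lambda>\<epsilon>. lr * (LINT y|lborel. J \<epsilon> y)) has_real_derivative (LINT z|lborel. Q z * g z)) (at 0)"
    unfolding J_def by (simp only: DERIV_cmult[OF R(3)])
  then show "\<exists>\<Phi>. (\<forall>\<epsilon>. psi lr \<rho> (\<lambda>z. - d_entropy Vh \<rho> z / 2 + \<epsilon> * g z) = ereal (\<Phi> \<epsilon>))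
      \<and> (\<Phi> has_real_derivative (LINT z|lborel. Q z * g z)) (at 0)"
    using psi by (intro exI[of _ "\<lambda>\<epsilon>. lr * (LINT y|lborel. J \<epsilon> y)"]) simp
qed

text \<open>Here a jump is a point of phase space, its flux is \<open>\<bar>a\<bar> \<rho>\<close> and reversal is the reflection. Kinetic
energy and \<open>Vh\<close> are both unchanged by a reflection, so only \<open>ln \<rho>\<close> contributes to the increment of
\<open>- d_entropy / 2\<close>.\<close>

lemma psi_hat_derivative:
  fixes \<rho> g :: "'a::euclidean_space \<times> 'a \<Rightarrow> real"
  assumes \<rho>: "\<rho> \<in> pos_schwartz" and U: "U \<in> C1" and g: "continuous_on UNIV g" "\<And>z. \<bar>g z\<bar> \<le> C"
    and int: "integrable lborel (\<lambda>z. rate U (fst z) (snd z) * \<rho> z)"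
  defines "Q \<equiv> \<lambda>z. \<bar>rate U (fst z) (snd z)\<bar> / 2 * (\<rho> (bounce U z) - \<rho> z)"
  shows "integrable lborel (\<lambda>z. Q z * g z)"
    and "\<exists>\<Phi>. (\<forall>\<epsilon>. psi_hat U \<rho> (\<lambda>z. - d_entropy Vh \<rho> z / 2 + \<epsilon> * g z) = ereal (\<Phi> \<epsilon>))
      \<and> (\<Phi> has_real_derivative (LINT z|lborel. Q z * g z)) (at 0)"
proof -
  note rp = pos_schwartz_pos[OF \<rho>]
  define a where "a z = \<bar>rate U (fst z) (snd z)\<bar>" for z
  have ab: "a (bounce U z) = a z" for z by (simp add: a_def snd_bounce rate_bounce)
  define A where "A z = a z * \<rho> z" for z
  define \<delta> where "\<delta> z = g (bounce U z) - g z" for z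
  note [measurable] = borel_measurable_bounce[OF U]
  have [measurable]: "g \<in> borel_measurable borel" by (rule borel_measurable_continuous_onI[OF g(1)])
  have A: "integrable lborel A" "0 \<le> A z" for z
  proof -
    have "A z = \<bar>rate U (fst z) (snd z) * \<rho> z\<bar>" for z using rp[of z] by (simp add: A_def a_def abs_mult)
    then show "integrable lborel A" "0 \<le> A z" using integrable_abs[OF int] by (simp_all add: A_def[abs_def])
  qed
  have [measurable]: "A \<in> borel_measurable borel" using borel_measurable_integrable[OF A(1)] by simp
  have \<delta>: "\<delta> \<in> borel_measurable borel" "\<bar>\<delta> z\<bar> \<le> 2 * C" "\<delta> (bounce U z) = - \<delta> z" for z
    using g(2)[of z] g(2)[of "bounce U z"] by (simp_all add: \<delta>_def[abs_def])
  note R = reversible_jump_derivative[OF lborel_distr_bounce[OF U] borel_measurable_bounce[OF U] bounce_bounce A \<delta>]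
  define J where "J \<epsilon> y = A y / 2 * exp (\<epsilon> * \<delta> y) + A (bounce U y) / 2 * exp (- (\<epsilon> * \<delta> y)) - sqrt (A y * A (bounce U y))" for \<epsilon> y
  have psi: "psi_hat U \<rho> (\<lambda>z. - d_entropy Vh \<rho> z / 2 + \<epsilon> * g z) = ereal ((1/2) * (LINT y|lborel. J \<epsilon> y))" for \<epsilon>
  proof -
    let ?\<xi> = "\<lambda>z. - d_entropy Vh \<rho> z / 2 + \<epsilon> * g z"
    have "bounce_weight U \<rho> z * (cosh (?\<xi> (bounce U z) - ?\<xi> z) - 1) = J \<epsilon> z" for z
    proof -
      have "?\<xi> (bounce U z) - ?\<xi> z = (ln (\<rho> z) - ln (\<rho> (bounce U z))) / 2 + \<epsilon> * \<delta> z"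
        by (cases z) (simp add: d_entropy_def bounce_def \<delta>_def field_simps)
      then have "bounce_weight U \<rho> z * (cosh (?\<xi> (bounce U z) - ?\<xi> z) - 1)
        = a z * (\<rho> z / 2 * exp (\<epsilon> * \<delta> z) + \<rho> (bounce U z) / 2 * exp (- (\<epsilon> * \<delta> z)) - sqrt (\<rho> z * \<rho> (bounce U z)))"
        using rp unfolding bounce_weight_def a_def mult.assoc by (simp only: sqrt_mult_cosh)
      moreover have "sqrt (A z * A (bounce U z)) = a z * sqrt (\<rho> z * \<rho> (bounce U z))"
      proof -
        have "A z * A (bounce U z) = (a z)\<^sup>2 * (\<rho> z * \<rho> (bounce U z))"
          by (simp add: A_def ab power2_eq_square)
        then show ?thesis by (simp add: real_sqrt_mult a_def)
      qed
      ultimately show ?thesis by (simp add: J_def A_def ab algebra_simps)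
    qed
    then have "psi_hat U \<rho> ?\<xi> = ereal (1 / 2) * ext_integral (J \<epsilon>)"
      unfolding psi_hat_eq by (simp only:)
    also have "integrable lborel (J \<epsilon>)" unfolding J_def[abs_def] by (rule R(1))
    then have "ext_integral (J \<epsilon>) = ereal (LINT y|lborel. J \<epsilon> y)" by (rule ext_integral_integrable)
    finally show ?thesis by simp
  qed
  note bounded = integrable_mult_bounded[OF _ borel_measurable_continuous_onI[OF g(1)] g(2)]
  have Ag: "integrable lborel (\<lambda>z. A z * g z)" by (rule bounded[OF A(1)])
  have ARg: "integrable lborel (\<lambda>z. A (bounce U z) * g z)" by (rule bounded[OF bounce_integral(1)[OF U A(1)]])
  have AgR: "integrable lborel (\<lambda>z. A z * g (bounce U z))"
    "(LINT z|lborel. A z * g (bounce U z)) = (LINT z|lborel. A (bounce U z) * g z)"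
    using bounce_integral[OF U ARg] by simp_all
  have Q: "Q z * g z = (1/2) * (A (bounce U z) * g z) - (1/2) * (A z * g z)" for z
    by (simp only: Q_def A_def ab) (simp add: a_def field_simps)
  show "integrable lborel (\<lambda>z. Q z * g z)" unfolding Q using Ag ARg by simp
  have "(LINT y|lborel. A y * \<delta> y) = (LINT z|lborel. A (bounce U z) * g z) - (LINT z|lborel. A z * g z)"
    unfolding \<delta>_def right_diff_distrib using AgR Ag by simp
  then have "(LINT z|lborel. Q z * g z) = (1/2) * (LINT y|lborel. A y * \<delta> y)"
    unfolding Q using Ag ARg by simp
  then have "((\<lambda>\<epsilon>. (1/2) * (LINT y|lborel. J \<epsilon> y)) has_real_derivative (LINT z|lborel. Q z * g z)) (at 0)"
    unfolding J_def by (simp only: DERIV_cmult[OF R(3)])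
  then show "\<exists>\<Phi>. (\<forall>\<epsilon>. psi_hat U \<rho> (\<lambda>z. - d_entropy Vh \<rho> z / 2 + \<epsilon> * g z) = ereal (\<Phi> \<epsilon>))
      \<and> (\<Phi> has_real_derivative (LINT z|lborel. Q z * g z)) (at 0)"
    using psi by (intro exI[of _ "\<lambda>\<epsilon>. (1/2) * (LINT y|lborel. J \<epsilon> y)"]) simp
qed

lemma psi_tilde_frechet:
  fixes V Vt :: "'a::euclidean_space \<Rightarrow> real"
  assumes \<rho>: "\<rho> \<in> pos_schwartz" and U: "(\<lambda>x. V x - Vt x) \<in> C1"
    and int: "integrable lborel (\<lambda>z. rate (\<lambda>x. V x - Vt x) (fst z) (snd z) * \<rho> z)"
  shows "has_frechet Cb2 (psi_tilde V Vt lr \<rho>) (\<lambda>z. - d_entropy Vh \<rho> z / 2) (dissipation (\<lambda>x. V x - Vt x) lr \<rho>)"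
  unfolding has_frechet_def
proof
  fix g :: "'a \<times> 'a \<Rightarrow> real" assume g: "g \<in> Cb2"
  define U where "U = (\<lambda>x. V x - Vt x)"
  have gc: "continuous_on UNIV g" by (intro C1_continuous Cb2_C1 g)
  obtain C where C: "\<And>z. \<bar>g z\<bar> \<le> C" using Cb2_bounded[OF g] by blast
  define D1 where "D1 z = lr * (gauss (snd z) * (LINT w|lborel. \<rho> (fst z, w)) - \<rho> z)" for z
  define D2 where "D2 z = \<bar>rate U (fst z) (snd z)\<bar> / 2 * (\<rho> (bounce U z) - \<rho> z)" for z
  have D: "dissipation U lr \<rho> z * g z = D1 z * g z + D2 z * g z" for z
    by (simp add: dissipation_def D1_def D2_def algebra_simps)
  note P = psi_derivative(1)[OF \<rho> gc C, where lr=lr, folded D1_def]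
    psi_derivative(2)[OF \<rho> gc C, where lr=lr and Vh=Vh, folded D1_def]
  note H = psi_hat_derivative(1)[OF \<rho> U gc C int, folded U_def, folded D2_def]
    psi_hat_derivative(2)[OF \<rho> U gc C int, where Vh=Vh, folded U_def, folded D2_def]
  obtain \<Phi>1 where \<Phi>1: "\<And>\<epsilon>. psi lr \<rho> (\<lambda>z. - d_entropy Vh \<rho> z / 2 + \<epsilon> * g z) = ereal (\<Phi>1 \<epsilon>)"
    "(\<Phi>1 has_real_derivative (LINT z|lborel. D1 z * g z)) (at 0)" using P(2) by blast
  obtain \<Phi>2 where \<Phi>2: "\<And>\<epsilon>. psi_hat U \<rho> (\<lambda>z. - d_entropy Vh \<rho> z / 2 + \<epsilon> * g z) = ereal (\<Phi>2 \<epsilon>)"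
    "(\<Phi>2 has_real_derivative (LINT z|lborel. D2 z * g z)) (at 0)" using H(2) by blast
  have psi: "psi_tilde V Vt lr \<rho> (\<lambda>z. - d_entropy Vh \<rho> z / 2 + \<epsilon> * g z) = ereal (\<Phi>1 \<epsilon> + \<Phi>2 \<epsilon>)" for \<epsilon>
    by (simp only: psi_tilde_def U_def[symmetric] \<Phi>1(1) \<Phi>2(1) plus_ereal.simps)
  have "((\<lambda>\<epsilon>. \<Phi>1 \<epsilon> + \<Phi>2 \<epsilon>) has_real_derivative (LINT z|lborel. dissipation U lr \<rho> z * g z)) (at 0)"
    using DERIV_add[OF \<Phi>1(2) \<Phi>2(2)] P(1) H(1) by (simp add: D)
  then show "integrable lborel (\<lambda>z. dissipation (\<lambda>x. V x - Vt x) lr \<rho> z * g z)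
       \<and> (\<forall>\<^sub>F \<epsilon> in nhds 0. \<bar>psi_tilde V Vt lr \<rho> (\<lambda>z. - d_entropy Vh \<rho> z / 2 + \<epsilon> * g z)\<bar> \<noteq> \<infinity>)
       \<and> ((\<lambda>\<epsilon>. real_of_ereal (psi_tilde V Vt lr \<rho> (\<lambda>z. - d_entropy Vh \<rho> z / 2 + \<epsilon> * g z)))
            has_real_derivative (LINT z|lborel. dissipation (\<lambda>x. V x - Vt x) lr \<rho> z * g z)) (at 0)"
    unfolding psi U_def[symmetric] D using P(1) H(1) by simp
qed

section \<open>Derivative of the entropy\<close>

text \<open>Where \<open>\<rho>\<close> is small, \<open>- ln \<rho> \<le> 2 / \<surd>\<rho>\<close>, and \<open>\<surd>\<rho>\<close> still decays faster than any power.\<close>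

lemma integrable_entropy_density:
  fixes \<rho> :: "'b::euclidean_space \<Rightarrow> real"
  assumes \<rho>: "\<rho> \<in> pos_schwartz"
  shows "integrable lborel (\<lambda>z. \<rho> z * ln (\<rho> z))"
proof -
  note rp = pos_schwartz_pos[OF \<rho>]
  have rc: "continuous_on UNIV \<rho>" by (intro C1_continuous pos_schwartz_C1 \<rho>)
  then have [measurable]: "\<rho> \<in> borel_measurable borel" by (rule borel_measurable_continuous_onI)
  define k where "k = DIM('b) + 2"
  obtain C where C: "\<And>z. \<rho> z * (1 + norm z) ^ (2 * k) \<le> C" using pos_schwartz_decay[OF \<rho>] by blast
  obtain M where M: "\<And>z. \<bar>\<rho> z\<bar> \<le> M" using pos_schwartz_bounded[OF \<rho>] by blast
  have s: "integrable lborel (\<lambda>z. sqrt (\<rho> z))"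
  proof (rule integrable_polynomial_decay)
    fix z :: 'b
    have "sqrt (\<rho> z) * (1 + norm z) ^ k = sqrt (\<rho> z * (1 + norm z) ^ (2 * k))"
      by (simp add: real_sqrt_mult power_mult[of _ 2 k] power_mult[of _ k 2] mult.commute[of 2] power_even_eq)
    also have "\<dots> \<le> sqrt C" using C by simp
    finally show "\<bar>sqrt (\<rho> z)\<bar> * (1 + norm z) ^ (DIM('b) + 2) \<le> sqrt C"
      using rp[of z] unfolding k_def[symmetric] by (simp add: less_imp_le)
  qed simp
  show ?thesis
  proof (rule Bochner_Integration.integrable_bound)
    show "integrable lborel (\<lambda>z. 2 * sqrt (\<rho> z) + M * \<rho> z)"
      using s pos_schwartz_integrable[OF \<rho>] by simp
    show "AE z in lborel. norm (\<rho> z * ln (\<rho> z)) \<le> norm (2 * sqrt (\<rho> z) + M * \<rho> z)"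
    proof (rule AE_I2)
      fix z
      have p: "0 < \<rho> z" "0 < sqrt (\<rho> z)" "0 \<le> M" using rp[of z] M[of z] by auto
      have "\<bar>\<rho> z * ln (\<rho> z)\<bar> \<le> 2 * sqrt (\<rho> z) + M * \<rho> z"
      proof (cases "1 \<le> \<rho> z")
        case True
        have "ln (\<rho> z) \<le> M" using ln_bound[of "\<rho> z"] M[of z] p by simp
        then have "\<rho> z * ln (\<rho> z) \<le> \<rho> z * M" using p by (intro mult_left_mono) auto
        then show ?thesis using True p by (simp add: mult.commute add_increasing)
      next
        case False
        have "ln (inverse (sqrt (\<rho> z))) \<le> inverse (sqrt (\<rho> z))" using p by (intro ln_bound) simp
        then have "- ln (\<rho> z) \<le> 2 * inverse (sqrt (\<rho> z))" using p by (simp add: ln_inverse ln_sqrt)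
        then have "\<rho> z * (- ln (\<rho> z)) \<le> \<rho> z * (2 * inverse (sqrt (\<rho> z)))"
          using p by (intro mult_left_mono) auto
        also have "\<dots> = 2 * sqrt (\<rho> z)"
          using p real_sqrt_mult_self[of "\<rho> z"] by (simp add: field_simps)
        finally have "\<rho> z * (- ln (\<rho> z)) \<le> 2 * sqrt (\<rho> z)" .
        moreover have "ln (\<rho> z) < 0" using False p by simp
        then have "\<bar>\<rho> z * ln (\<rho> z)\<bar> = \<rho> z * (- ln (\<rho> z))"
          using p by (simp add: abs_mult)
        moreover have "0 \<le> M * \<rho> z" using p by simp
        ultimately show ?thesis by linarith
      qed
      then show "norm (\<rho> z * ln (\<rho> z)) \<le> norm (2 * sqrt (\<rho> z) + M * \<rho> z)" by simp
    qed
  qed simp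
qed

text \<open>The relative perturbation \<open>q = g / \<rho>\<close> is continuous with compact support. With
\<open>\<rho> + \<epsilon> g = \<rho> (1 + \<epsilon> q)\<close> the logarithm splits, and everything except \<open>\<rho> (1 + \<epsilon> q) ln (1 + \<epsilon> q)\<close> is
affine in \<open>\<epsilon>\<close>. In the energy the factor \<open>q\<close> reduces integrability along \<open>g\<close> to that of the energy
density of \<open>\<rho>\<close>.\<close>

lemma entropy_frechet:
  fixes \<rho> :: "'a::euclidean_space \<times> 'a \<Rightarrow> real"
  assumes \<rho>: "\<rho> \<in> pos_schwartz" and E: "integrable lborel (energy_term Vh \<rho>)"
  shows "has_frechet Cc2 (entropy Vh) \<rho> (d_entropy Vh \<rho>)"
  unfolding has_frechet_def
proof
  fix g :: "'a \<times> 'a \<Rightarrow> real" assume g: "g \<in> Cc2"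
  note rp = pos_schwartz_pos[OF \<rho>]
  have rc: "continuous_on UNIV \<rho>" by (intro C1_continuous pos_schwartz_C1 \<rho>)
  have gc: "continuous_on UNIV g" by (intro C1_continuous Cb2_C1 Cc2_Cb2 g)
  obtain R where R: "\<And>z. z \<notin> cball 0 R \<Longrightarrow> g z = 0" using Cc2_support[OF g] by blast
  note cs = integrable_compact_support[OF _ compact_cball[of "0::'a\<times>'a" R]]
  have rn: "\<rho> z \<noteq> 0" for z using rp[of z] by simp
  define q where "q z = g z / \<rho> z" for z
  have qc: "continuous_on UNIV q" unfolding q_def[abs_def] by (intro continuous_intros gc rc) (simp add: rn)
  have q0: "q z = 0" if "z \<notin> cball 0 R" for z using R[OF that] by (simp add: q_def)
  have rq: "\<rho> z * q z = g z" for z by (simp add: q_def rn)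
  obtain M where M: "0 < M" "\<And>z. \<bar>q z\<bar> \<le> M"
    using compact_support_bounded[OF qc compact_cball q0] by blast
  \<comment> \<open>For \<open>\<bar>\<epsilon>\<bar> < d\<close> the factor \<open>1 + \<epsilon> q\<close> stays between \<open>1 / 2\<close> and \<open>3 / 2\<close>.\<close>
  define d where "d = 1 / (2 * M)"
  have d: "0 < d" using M by (simp add: d_def)
  have near1: "1 / 2 \<le> 1 + \<epsilon> * q z" "1 + \<epsilon> * q z \<le> 3 / 2" if "\<bar>\<epsilon>\<bar> < d" for \<epsilon> z
  proof -
    have "\<bar>\<epsilon> * q z\<bar> \<le> d * M" unfolding abs_mult using that M by (intro mult_mono) auto
    also have "\<dots> = 1 / 2" using M by (simp add: d_def)
    finally show "1 / 2 \<le> 1 + \<epsilon> * q z" "1 + \<epsilon> * q z \<le> 3 / 2" by linarith+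
  qed
  define e where "e = energy_term Vh \<rho>"
  have e: "integrable lborel e" using E by (simp add: e_def)
  have eg: "energy_term Vh g z = q z * e z" for z
    using rq[of z] by (simp add: e_def energy_term_def case_prod_beta') (metis mult.assoc mult.commute)
  have qe: "integrable lborel (\<lambda>z. q z * e z)"
    using integrable_mult_bounded[OF e borel_measurable_continuous_onI[OF qc] M(2)] by (simp add: mult.commute)
  have gi: "integrable lborel g" by (rule cs[OF gc R])
  have gl: "integrable lborel (\<lambda>z. g z * ln (\<rho> z))"
    by (rule cs) (auto intro!: continuous_intros gc rc simp: rn R)
  note r = integrable_entropy_density[OF \<rho>]
  define h where "h \<epsilon> z = \<rho> z * ((1 + \<epsilon> * q z) * ln (1 + \<epsilon> * q z))" for \<epsilon> z
  have h: "integrable lborel (h \<epsilon>)" if "\<bar>\<epsilon>\<bar> < d" for \<epsilon>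
  proof (rule cs)
    have "1 + \<epsilon> * q z \<noteq> 0" for z using near1[OF that, of z] by linarith
    then show "continuous_on UNIV (h \<epsilon>)"
      unfolding h_def[abs_def] by (intro continuous_intros rc qc) auto
  qed (simp add: h_def q0)
  define F where "F \<epsilon> = ((LINT z|lborel. \<rho> z * ln (\<rho> z)) + \<epsilon> * (LINT z|lborel. g z * ln (\<rho> z)) + (LINT z|lborel. h \<epsilon> z))
      + ((LINT z|lborel. e z) + \<epsilon> * (LINT z|lborel. q z * e z))" for \<epsilon>
  have ent: "entropy Vh (\<lambda>z. \<rho> z + \<epsilon> * g z) = ereal (F \<epsilon>)" if \<epsilon>: "\<bar>\<epsilon>\<bar> < d" for \<epsilon>
  proof -
    have 1: "(\<rho> z + \<epsilon> * g z) * ln (\<rho> z + \<epsilon> * g z) = \<rho> z * ln (\<rho> z) + \<epsilon> * (g z * ln (\<rho> z)) + h \<epsilon> z" for z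
    proof -
      have x: "\<rho> z + \<epsilon> * g z = \<rho> z * (1 + \<epsilon> * q z)" using rq[of z] by (simp add: algebra_simps)
      have "ln (\<rho> z * (1 + \<epsilon> * q z)) = ln (\<rho> z) + ln (1 + \<epsilon> * q z)"
        using near1[OF \<epsilon>, of z] rp[of z] by (intro ln_mult_pos) linarith+
      then show ?thesis unfolding x h_def using rq[of z, symmetric] by (simp add: algebra_simps)
    qed
    have 2: "energy_term Vh (\<lambda>z. \<rho> z + \<epsilon> * g z) z = e z + \<epsilon> * (q z * e z)" for z
    proof -
      have "energy_term Vh (\<lambda>z. \<rho> z + \<epsilon> * g z) z = e z + \<epsilon> * energy_term Vh g z"
        unfolding e_def by (simp add: energy_term_def case_prod_beta' algebra_simps)
      then show ?thesis by (simp only: eg)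
    qed
    have "ext_integral (\<lambda>z. (\<rho> z + \<epsilon> * g z) * ln (\<rho> z + \<epsilon> * g z))
        = ereal ((LINT z|lborel. \<rho> z * ln (\<rho> z)) + \<epsilon> * (LINT z|lborel. g z * ln (\<rho> z)) + (LINT z|lborel. h \<epsilon> z))"
      unfolding 1 using r gl h[OF \<epsilon>] by (subst ext_integral_integrable) auto
    moreover have "ext_integral (energy_term Vh (\<lambda>z. \<rho> z + \<epsilon> * g z)) = ereal ((LINT z|lborel. e z) + \<epsilon> * (LINT z|lborel. q z * e z))"
      unfolding 2[abs_def] using e qe by (subst ext_integral_integrable) auto
    ultimately show ?thesis by (simp add: entropy_def F_def)
  qed
  have h': "((\<lambda>\<epsilon>. LINT z|lborel. h \<epsilon> z) has_real_derivative (LINT z|lborel. g z * (ln (1 + 0 * q z) + 1))) (at 0)"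
  proof (rule has_real_derivative_integral(2)[where d=d and B="\<lambda>z. 2 * \<bar>g z\<bar>", OF d h])
    fix \<epsilon> z assume \<epsilon>: "\<bar>\<epsilon>\<bar> < d"
    have p: "0 < 1 + \<epsilon> * q z" using near1[OF \<epsilon>, of z] by linarith
    have du: "((\<lambda>s. 1 + s * q z) has_real_derivative q z) (at \<epsilon>)"
      by (auto intro!: derivative_eq_intros)
    have e1: "1 / (1 + \<epsilon> * q z) * q z * (1 + \<epsilon> * q z) = q z" using p by simp
    show "((\<lambda>s. h s z) has_real_derivative g z * (ln (1 + \<epsilon> * q z) + 1)) (at \<epsilon>)"
      unfolding h_def rq[of z, symmetric]
      by (rule DERIV_cong[OF DERIV_cmult[OF DERIV_mult[OF du DERIV_chain2[OF DERIV_ln_divide[OF p] du]]]])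
        (simp only: e1, simp add: algebra_simps)
    have "ln (1 + \<epsilon> * q z) \<le> 1" using ln_le_minus_one[OF p] near1[OF \<epsilon>, of z] by linarith
    moreover have "- ln (1 + \<epsilon> * q z) \<le> 1"
    proof -
      have "ln (inverse (1 + \<epsilon> * q z)) \<le> inverse (1 + \<epsilon> * q z) - 1" using p by (intro ln_le_minus_one) simp
      moreover have "inverse (1 + \<epsilon> * q z) \<le> inverse (1 / 2)" using near1[OF \<epsilon>, of z] by (intro le_imp_inverse_le) auto
      ultimately show ?thesis using p by (simp add: ln_inverse)
    qed
    ultimately have "\<bar>ln (1 + \<epsilon> * q z) + 1\<bar> \<le> 2" by linarith
    then show "\<bar>g z * (ln (1 + \<epsilon> * q z) + 1)\<bar> \<le> 2 * \<bar>g z\<bar>"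
      unfolding abs_mult mult.commute[of 2] by (intro mult_left_mono) auto
  qed (use gi in auto)
  define D where "D = (LINT z|lborel. g z * ln (\<rho> z)) + (LINT z|lborel. g z) + (LINT z|lborel. q z * e z)"
  have F': "(F has_real_derivative D) (at 0)"
    unfolding F_def[abs_def] D_def using h' by (auto intro!: derivative_eq_intros)
  have Dg: "d_entropy Vh \<rho> z * g z = g z * ln (\<rho> z) + g z + q z * e z" for z
  proof -
    have "d_entropy Vh \<rho> z * g z = g z * ln (\<rho> z) + g z + energy_term Vh g z"
      by (simp add: d_entropy_def energy_term_def case_prod_beta' algebra_simps)
    then show ?thesis by (simp only: eg)
  qed
  have ev: "\<forall>\<^sub>F \<epsilon> in nhds 0. \<epsilon> \<in> {-d<..<d}" using d by (intro eventually_nhds_in_open) auto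
  have "integrable lborel (\<lambda>z. d_entropy Vh \<rho> z * g z)" "(LINT z|lborel. d_entropy Vh \<rho> z * g z) = D"
    unfolding Dg D_def using gl gi qe by simp_all
  moreover have "\<forall>\<^sub>F \<epsilon> in nhds 0. \<bar>entropy Vh (\<lambda>z. \<rho> z + \<epsilon> * g z)\<bar> \<noteq> \<infinity>"
    using ev by eventually_elim (simp add: ent abs_less_iff)
  moreover have "((\<lambda>\<epsilon>. real_of_ereal (entropy Vh (\<lambda>z. \<rho> z + \<epsilon> * g z))) has_real_derivative D) (at 0)"
    by (rule has_field_derivative_transform_within_open[OF F', of "{-d<..<d}"]) (use d in \<open>auto simp: ent abs_less_iff\<close>)
  ultimately show "integrable lborel (\<lambda>z. d_entropy Vh \<rho> z * g z)
       \<and> (\<forall>\<^sub>F \<epsilon> in nhds 0. \<bar>entropy Vh (\<lambda>z. \<rho> z + \<epsilon> * g z)\<bar> \<noteq> \<infinity>)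
       \<and> ((\<lambda>\<epsilon>. real_of_ereal (entropy Vh (\<lambda>z. \<rho> z + \<epsilon> * g z)))
            has_real_derivative (LINT z|lborel. d_entropy Vh \<rho> z * g z)) (at 0)" by simp
qed

section \<open>The gradient structure\<close>

theorem proposition6p3:
  fixes V Vt :: "'a::euclidean_space \<Rightarrow> real" and lambda_r :: real
  assumes "V \<in> C1" and "Vt \<in> C1" and "lambda_r > 0"
    and "integrable lborel (mu V)" and "(LINT z|lborel. mu V z) = 1"
  shows "(\<forall>f \<in> Cb2. is_formal_adjoint (mu V) (gen V Vt lambda_r) f (gen_star V Vt lambda_r f))
    \<and> (\<forall>\<rho> \<in> pos_schwartz.
          is_formal_adjoint (\<lambda>_. 1) (gen V Vt lambda_r) \<rho> (gen' V Vt lambda_r \<rho>)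
        \<and> is_formal_adjoint (\<lambda>_. 1) (gen_A V Vt lambda_r) \<rho> (W_tilde V Vt lambda_r \<rho>)
        \<and> (\<forall>\<xi> \<in> borel_measurable borel. 0 \<le> psi_tilde V Vt lambda_r \<rho> \<xi>)
        \<and> (\<forall>\<xi> \<in> borel_measurable borel. \<forall>\<eta> \<in> borel_measurable borel. \<forall>t \<in> {0..1::real}.
              psi_tilde V Vt lambda_r \<rho> (\<lambda>z. (1 - t) * \<xi> z + t * \<eta> z)
                \<le> ereal (1 - t) * psi_tilde V Vt lambda_r \<rho> \<xi> + ereal t * psi_tilde V Vt lambda_r \<rho> \<eta>))
    \<and> (\<forall>Vh :: 'a \<Rightarrow> real. \<forall>\<rho> \<in> pos_schwartz.
          integrable lborel (energy_term Vh \<rho>) \<longrightarrow>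
          integrable lborel (\<lambda>(x, v). rate (\<lambda>y. V y - Vt y) x v * \<rho> (x, v)) \<longrightarrow>
            has_frechet Cc2 (entropy Vh) \<rho> (d_entropy Vh \<rho>)
          \<and> (\<exists>D. has_frechet Cb2 (psi_tilde V Vt lambda_r \<rho>) (\<lambda>z. - d_entropy Vh \<rho> z / 2) D
               \<and> (\<forall>z. gen' V Vt lambda_r \<rho> z = W_tilde V Vt lambda_r \<rho> z + D z)))"
proof (intro conjI ballI allI impI)
  have U: "(\<lambda>x. V x - Vt x) \<in> C1" by (rule C1_diff(1)[OF assms(1,2)])
  have lr: "0 \<le> lambda_r" using assms(3) by simp
  show "is_formal_adjoint (mu V) (gen V Vt lambda_r) f (gen_star V Vt lambda_r f)" if "f \<in> Cb2" for f
    using gen_star_adjoint[OF assms(1,2,4) that, of lambda_r] gen_star_eq[OF assms(1,2,4) that, of lambda_r] by simp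
  fix \<rho> :: "'a \<times> 'a \<Rightarrow> real" assume \<rho>: "\<rho> \<in> pos_schwartz"
  note L = gen'_adjoint[OF assms(1,2) \<rho>, of lambda_r] and W = W_tilde_adjoint[OF assms(1,2,4) \<rho>, of lambda_r]
  show "is_formal_adjoint (\<lambda>_. 1) (gen V Vt lambda_r) \<rho> (gen' V Vt lambda_r \<rho>)" using L by simp
  show "is_formal_adjoint (\<lambda>_. 1) (gen_A V Vt lambda_r) \<rho> (W_tilde V Vt lambda_r \<rho>)" using W by simp
  show "0 \<le> psi_tilde V Vt lambda_r \<rho> \<xi>" for \<xi> by (rule psi_tilde_nonneg[OF \<rho> U lr])
  show "psi_tilde V Vt lambda_r \<rho> (\<lambda>z. (1 - t) * \<xi> z + t * \<eta> z)
      \<le> ereal (1 - t) * psi_tilde V Vt lambda_r \<rho> \<xi> + ereal t * psi_tilde V Vt lambda_r \<rho> \<eta>"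
    if "\<xi> \<in> borel_measurable borel" "\<eta> \<in> borel_measurable borel" "t \<in> {0..1}" for \<xi> \<eta> t
    using that by (intro psi_tilde_convex[OF \<rho> U lr]) auto
  fix Vh :: "'a \<Rightarrow> real"
  assume E: "integrable lborel (energy_term Vh \<rho>)"
    and I: "integrable lborel (\<lambda>(x, v). rate (\<lambda>y. V y - Vt y) x v * \<rho> (x, v))"
  show "has_frechet Cc2 (entropy Vh) \<rho> (d_entropy Vh \<rho>)" by (rule entropy_frechet[OF \<rho> E])
  have I': "integrable lborel (\<lambda>z. rate (\<lambda>x. V x - Vt x) (fst z) (snd z) * \<rho> z)"
    using I by (simp add: case_prod_beta')
  show "\<exists>D. has_frechet Cb2 (psi_tilde V Vt lambda_r \<rho>) (\<lambda>z. - d_entropy Vh \<rho> z / 2) D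
               \<and> (\<forall>z. gen' V Vt lambda_r \<rho> z = W_tilde V Vt lambda_r \<rho> z + D z)"
    using psi_tilde_frechet[OF \<rho> U I', of lambda_r Vh] unfolding L(2) W(2) fokker_planck_decomposition by blast
qed

end
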